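(* Let $n\ge 1$ and let $\Gamma$ be a simple graph on the vertex set $\{P,Q\}\cup[n]$ in which $P$ and $Q$ are dominating vertices, i.e. each of $P,Q$ is adjacent to every other vertex of $\Gamma$. Let $\mathrm{Tree}(\Gamma)$ be the set of $\Gamma$-stable trees and, for $T\in\mathrm{Tree}(\Gamma)$, let $i(T)$ be its number of internal edges. Let $\mathrm{ACO}(\Gamma)$ be the set of acyclic orientations of the induced subgraph $\Gamma\smallsetminus\{P,Q\}$ on $[n]$. Then, up to sign, $$\sum_{T\in\mathrm{Tree}(\Gamma)}(-1)^{i(T)}=\pm|\mathrm{ACO}(\Gamma)|,\qquad\text{i.e.}\qquad \Big|\sum_{T\in\mathrm{Tree}(\Gamma)}(-1)^{i(T)}\Big|=|\mathrm{ACO}(\Gamma)|.$$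
   Context: A $\Gamma$-stable tree (the dual tree of a point of Fry's graphically stable moduli space $\overline{M}_{0,\Gamma}$ whose marked points are pairwise distinct) is, up to isomorphism preserving leaf labels, a finite tree $T$ whose degree-one vertices (leaves) are labeled bijectively by the vertices of $\Gamma$, all of whose other vertices (internal vertices) have degree at least $3$, and such that for every internal edge $e$ (an edge joining two internal vertices), each of the two connected components of $T\smallsetminus e$ contains two leaves whose labels are adjacent in $\Gamma$. The tree with a single internal vertex (and no internal edges) is included. $i(T)$ is the number of internal edges of $T$. Equivalently, $\mathrm{Tree}(\Gamma)$ indexes the boundary strata of $\overline{M}_{0,\Gamma}$ and $i(T)$ is the codimension of the stratum. *)

theory Defs
  imports Main
begin

record 'v sgraph =
  verts :: "'v set"
  edges :: "'v set set"

definition finite_simple_graph :: "('v, 'z) sgraph_scheme \<Rightarrow> bool" where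
  "finite_simple_graph G \<longleftrightarrow>
     finite (verts G) \<and> (\<forall>e\<in>edges G. e \<subseteq> verts G \<and> card e = 2)"

definition dominating :: "('v, 'z) sgraph_scheme \<Rightarrow> 'v \<Rightarrow> bool" where
  "dominating G p \<longleftrightarrow> p \<in> verts G \<and> (\<forall>v\<in>verts G - {p}. {p, v} \<in> edges G)"

definition induced_subgraph :: "'v sgraph \<Rightarrow> 'v set \<Rightarrow> 'v sgraph" where
  "induced_subgraph G W =
     \<lparr>verts = verts G \<inter> W, edges = {e \<in> edges G. e \<subseteq> W}\<rparr>"

definition orientation :: "'v sgraph \<Rightarrow> ('v \<times> 'v) set \<Rightarrow> bool" where
  "orientation G D \<longleftrightarrow>
     (\<forall>(u, v)\<in>D. {u, v} \<in> edges G) \<and>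
     (\<forall>u v. {u, v} \<in> edges G \<longrightarrow> ((u, v) \<in> D \<longleftrightarrow> (v, u) \<notin> D))"

definition acyclic_orientations :: "'v sgraph \<Rightarrow> ('v \<times> 'v) set set" where
  "acyclic_orientations G = {D. orientation G D \<and> acyclic D}"

definition adj_rel :: "('v, 'z) sgraph_scheme \<Rightarrow> ('v \<times> 'v) set" where
  "adj_rel G = {(u, v). {u, v} \<in> edges G}"

definition component_of :: "('v, 'z) sgraph_scheme \<Rightarrow> 'v \<Rightarrow> 'v set" where
  "component_of G u = {v \<in> verts G. (u, v) \<in> (adj_rel G)\<^sup>*}"

definition conn_components :: "('v, 'z) sgraph_scheme \<Rightarrow> 'v set set" where
  "conn_components G = component_of G ` verts G"

definition connected_graph :: "('v, 'z) sgraph_scheme \<Rightarrow> bool" where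
  "connected_graph G \<longleftrightarrow>
     verts G \<noteq> {} \<and> (\<forall>u\<in>verts G. \<forall>v\<in>verts G. (u, v) \<in> (adj_rel G)\<^sup>*)"

definition is_cycle :: "('v, 'z) sgraph_scheme \<Rightarrow> 'v list \<Rightarrow> bool" where
  "is_cycle G vs \<longleftrightarrow>
     3 \<le> length vs \<and> distinct vs \<and>
     (\<forall>i<length vs. {vs ! i, vs ! (Suc i mod length vs)} \<in> edges G)"

definition is_tree :: "('v, 'z) sgraph_scheme \<Rightarrow> bool" where
  "is_tree G \<longleftrightarrow>
     finite_simple_graph G \<and> connected_graph G \<and> (\<nexists>vs. is_cycle G vs)"

definition degree :: "('v, 'z) sgraph_scheme \<Rightarrow> 'v \<Rightarrow> nat" where
  "degree G v = card {e \<in> edges G. v \<in> e}"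

definition leaves :: "('v, 'z) sgraph_scheme \<Rightarrow> 'v set" where
  "leaves G = {v \<in> verts G. degree G v = 1}"

definition internal_verts :: "('v, 'z) sgraph_scheme \<Rightarrow> 'v set" where
  "internal_verts G = verts G - leaves G"

definition internal_edges :: "('v, 'z) sgraph_scheme \<Rightarrow> 'v set set" where
  "internal_edges G = {e \<in> edges G. e \<subseteq> internal_verts G}"

definition delete_edge :: "('v, 'z) sgraph_scheme \<Rightarrow> 'v set \<Rightarrow> ('v, 'z) sgraph_scheme" where
  "delete_edge G e = G\<lparr>edges := edges G - {e}\<rparr>"

text \<open>In a leaf-labelled graph, \<open>leaf_of a\<close> is the leaf carrying the label \<open>a\<close>;
  its values outside the intended label set are irrelevant.\<close>

record ('v, 'a) labelled_graph = "'v sgraph" +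
  leaf_of :: "'a \<Rightarrow> 'v"

definition stable_tree :: "'a sgraph \<Rightarrow> ('v, 'a) labelled_graph \<Rightarrow> bool" where
  "stable_tree \<Gamma> T \<longleftrightarrow>
     is_tree T \<and>
     bij_betw (leaf_of T) (verts \<Gamma>) (leaves T) \<and>
     (\<forall>v\<in>internal_verts T. 3 \<le> degree T v) \<and>
     (\<forall>e\<in>internal_edges T. \<forall>C\<in>conn_components (delete_edge T e).
        \<exists>a b. {a, b} \<in> edges \<Gamma> \<and> leaf_of T a \<in> C \<and> leaf_of T b \<in> C)"

definition label_iso ::
    "'a set \<Rightarrow> ('v, 'a) labelled_graph \<Rightarrow> ('w, 'a) labelled_graph \<Rightarrow> bool" where
  "label_iso A S T \<longleftrightarrow>
     (\<exists>f. bij_betw f (verts S) (verts T) \<and>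
          (\<lambda>e. f ` e) ` edges S = edges T \<and>
          (\<forall>a\<in>A. f (leaf_of S a) = leaf_of T a))"

text \<open>Every finite tree has an isomorphic copy with vertices in \<open>nat\<close>, so the
  isomorphism classes of all stable trees are represented by classes of stable trees with
  vertices in \<open>nat\<close>.\<close>

definition stable_tree_rel ::
    "'a sgraph \<Rightarrow> ((nat, 'a) labelled_graph \<times> (nat, 'a) labelled_graph) set" where
  "stable_tree_rel \<Gamma> =
     {(S, T). stable_tree \<Gamma> S \<and> stable_tree \<Gamma> T \<and> label_iso (verts \<Gamma>) S T}"

definition Tree :: "'a sgraph \<Rightarrow> (nat, 'a) labelled_graph set set" where
  "Tree \<Gamma> = {T. stable_tree \<Gamma> T} // stable_tree_rel \<Gamma>"

text \<open>The number of internal edges of an isomorphism class is that of any of its members;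
  see \<open>num_internal_edges_eq\<close> below.\<close>

definition num_internal_edges :: "('v, 'a) labelled_graph set \<Rightarrow> nat" where
  "num_internal_edges X = the_elem ((\<lambda>T. card (internal_edges T)) ` X)"

lemma label_iso_refl: "label_iso A T T"
  unfolding label_iso_def by (intro exI[of _ id]) auto

lemma label_iso_sym:
  assumes "finite_simple_graph S" "label_iso A S T" "leaf_of S ` A \<subseteq> verts S"
  shows "label_iso A T S"
proof -
  from assms(2) obtain f where f: "bij_betw f (verts S) (verts T)"
    "(\<lambda>e. f ` e) ` edges S = edges T" "\<forall>a\<in>A. f (leaf_of S a) = leaf_of T a"
    unfolding label_iso_def by blast
  let ?g = "inv_into (verts S) f"
  have inj: "inj_on f (verts S)" using f(1) by (rule bij_betw_imp_inj_on)
  have "?g ` f ` e = e" if "e \<in> edges S" for e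
    using that assms(1) inj unfolding finite_simple_graph_def by (simp add: inv_into_image_cancel)
  then have "(\<lambda>e. ?g ` e) ` edges T = edges S"
    unfolding f(2)[symmetric] image_image by simp
  moreover have "\<forall>a\<in>A. ?g (leaf_of T a) = leaf_of S a"
  proof
    fix a assume a: "a \<in> A"
    then have "leaf_of S a \<in> verts S" using assms(3) by blast
    then show "?g (leaf_of T a) = leaf_of S a" using f(3) a inv_into_f_f[OF inj] by force
  qed
  ultimately show ?thesis
    unfolding label_iso_def using bij_betw_inv_into[OF f(1)] by blast
qed

lemma label_iso_trans:
  assumes "label_iso A S T" "label_iso A T U"
  shows "label_iso A S U"
proof -
  from assms(1) obtain f where f: "bij_betw f (verts S) (verts T)"
    "(\<lambda>e. f ` e) ` edges S = edges T" "\<forall>a\<in>A. f (leaf_of S a) = leaf_of T a"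
    unfolding label_iso_def by blast
  from assms(2) obtain g where g: "bij_betw g (verts T) (verts U)"
    "(\<lambda>e. g ` e) ` edges T = edges U" "\<forall>a\<in>A. g (leaf_of T a) = leaf_of U a"
    unfolding label_iso_def by blast
  have "(\<lambda>e. (g \<circ> f) ` e) ` edges S = edges U"
    unfolding g(2)[symmetric] f(2)[symmetric] by (simp add: image_image image_comp)
  then show ?thesis
    unfolding label_iso_def using bij_betw_trans[OF f(1) g(1)] f(3) g(3)
    by (intro exI[of _ "g \<circ> f"]) auto
qed

lemma equiv_stable_tree_rel: "equiv {T. stable_tree \<Gamma> T} (stable_tree_rel \<Gamma>)"
proof (rule equivI)
  show "stable_tree_rel \<Gamma> \<subseteq> {T. stable_tree \<Gamma> T} \<times> {T. stable_tree \<Gamma> T}"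
    unfolding stable_tree_rel_def by blast
  show "refl_on {T. stable_tree \<Gamma> T} (stable_tree_rel \<Gamma>)"
    unfolding refl_on_def stable_tree_rel_def by (auto intro: label_iso_refl)
  show "trans (stable_tree_rel \<Gamma>)"
    unfolding trans_def stable_tree_rel_def by (auto intro: label_iso_trans)
  show "sym (stable_tree_rel \<Gamma>)"
  proof (rule symI)
    fix S T assume "(S, T) \<in> stable_tree_rel \<Gamma>"
    then have st: "stable_tree \<Gamma> S" "stable_tree \<Gamma> T" "label_iso (verts \<Gamma>) S T"
      unfolding stable_tree_rel_def by auto
    have "finite_simple_graph S" using st(1) unfolding stable_tree_def is_tree_def by blast
    moreover have "leaf_of S ` verts \<Gamma> \<subseteq> verts S"
      using st(1) unfolding stable_tree_def leaves_def bij_betw_def by blast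
    ultimately show "(T, S) \<in> stable_tree_rel \<Gamma>"
      using st label_iso_sym unfolding stable_tree_rel_def by blast
  qed
qed

lemma label_iso_card_internal_edges:
  assumes "finite_simple_graph S" "label_iso A S T"
  shows "card (internal_edges S) = card (internal_edges T)"
proof -
  from assms(2) obtain f where f: "bij_betw f (verts S) (verts T)"
    "(\<lambda>e. f ` e) ` edges S = edges T"
    unfolding label_iso_def by blast
  have inj: "inj_on f (verts S)" using f(1) by (rule bij_betw_imp_inj_on)
  have sub: "e \<subseteq> verts S" if "e \<in> edges S" for e
    using that assms(1) unfolding finite_simple_graph_def by blast
  have injE: "inj_on (\<lambda>e. f ` e) (edges S)"
    using inj_on_image_eq_iff[OF inj sub sub] by (intro inj_onI) blast
  have deg: "degree T (f v) = degree S v" if v: "v \<in> verts S" for v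
  proof -
    have "f v \<in> f ` e \<longleftrightarrow> v \<in> e" if "e \<in> edges S" for e
      using inj_on_image_mem_iff[OF inj v sub[OF that]] .
    then have "{e \<in> edges T. f v \<in> e} = (\<lambda>e. f ` e) ` {e \<in> edges S. v \<in> e}"
      unfolding f(2)[symmetric] by auto
    moreover have "inj_on (\<lambda>e. f ` e) {e \<in> edges S. v \<in> e}"
      by (rule inj_on_subset[OF injE]) blast
    ultimately show ?thesis unfolding degree_def by (simp add: card_image)
  qed
  have vT: "verts T = f ` verts S" using f(1) unfolding bij_betw_def by simp
  have iv: "f v \<in> internal_verts T \<longleftrightarrow> v \<in> internal_verts S" if "v \<in> verts S" for v
    using that deg vT unfolding internal_verts_def leaves_def by auto
  have "f ` e \<subseteq> internal_verts T \<longleftrightarrow> e \<subseteq> internal_verts S" if "e \<in> edges S" for e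
    using sub[OF that] iv by blast
  then have "internal_edges T = (\<lambda>e. f ` e) ` internal_edges S"
    unfolding internal_edges_def f(2)[symmetric] by auto
  moreover have "inj_on (\<lambda>e. f ` e) (internal_edges S)"
    by (rule inj_on_subset[OF injE]) (auto simp: internal_edges_def)
  ultimately show ?thesis by (simp add: card_image)
qed

lemma num_internal_edges_eq:
  assumes "X \<in> Tree \<Gamma>" "T \<in> X"
  shows "num_internal_edges X = card (internal_edges T)"
proof -
  have eq: "card (internal_edges S) = card (internal_edges T)" if "S \<in> X" for S
  proof -
    have "(S, T) \<in> stable_tree_rel \<Gamma>"
      using quotient_eq_iff[OF equiv_stable_tree_rel, of X \<Gamma> X S T] assms that
      unfolding Tree_def by blast
    then have "finite_simple_graph S" "label_iso (verts \<Gamma>) S T"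
      by (simp_all add: stable_tree_rel_def stable_tree_def is_tree_def)
    then show ?thesis by (rule label_iso_card_internal_edges)
  qed
  have "(\<lambda>S. card (internal_edges S)) ` X = (\<lambda>S. card (internal_edges T)) ` X"
    by (rule image_cong[OF refl eq])
  also have "\<dots> = {card (internal_edges T)}" using assms(2) by blast
  finally show ?thesis unfolding num_internal_edges_def by simp
qed

end

theory Submission
  imports Defs
begin

text \<open>
  Root every tree at the leaf labelled \<open>P\<close>. Recording for each internal edge the labels on the
  side away from \<open>P\<close> identifies a stable tree with a laminar family of proper subsets of
  \<open>A = {Q} \<union> [n]\<close>, each spanning an edge of \<open>\<Gamma>\<close>; the side containing \<open>P\<close> imposes no condition
  because \<open>P\<close> is dominating. Let \<open>f A\<close> be the signed number of these families. Without the
  properness condition the families on a set that spans an edge cancel in pairs, by toggling the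
  whole set. Splitting off the largest member \<open>{Q} \<union> T\<close> containing \<open>Q\<close> thus yields
  \<open>f ({Q} \<union> N) = \<Sum>T \<subset> N. w T * [N - T is independent]\<close> with \<open>w {} = 1\<close> and
  \<open>w T = - f ({Q} \<union> T)\<close> otherwise. The numbers \<open>(- 1) ^ card T * |ACO T|\<close> satisfy the same
  recurrence, by inclusion-exclusion over the sources of an acyclic orientation.
\<close>

section \<open>Signed counts of laminar families\<close>

text \<open>Singling out \<open>Q\<close> is what closes the recurrence. A set holding
  \<open>Q\<close> and one more label always spans an edge, so the members strictly inside the
  largest member containing \<open>Q\<close> form an arbitrary family of the same kind, with that
  set itself barred; the remaining members lie in its complement, where no set is barred, so their
  signed count is 1 or 0 by toggling. The value \<open>w {} = 1\<close> is not the instance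
  \<open>- f {Q} = - 1\<close> of the general formula: the index \<open>{Q}\<close> records that no
  member contains \<open>Q\<close>, so no extra member changes the sign. Conversely, a family gives
  back its tree as the Hasse diagram of its members together with the singletons,
  \<open>L - {P}\<close> and \<open>L\<close>, where \<open>L\<close> is the set of all labels. A
  label-preserving isomorphism of such diagrams respects parents and fixes the leaves, hence fixes
  every label set in the family; so distinct families give non-isomorphic trees.\<close>

lemma sum_minus_one_card_toggle:
  fixes x :: 'a
  assumes fin: "finite \<A>" "\<And>F. F \<in> \<A> \<Longrightarrow> finite F"
    and ins: "\<And>F. F \<in> \<A> \<Longrightarrow> insert x F \<in> \<A>"
    and del: "\<And>F. F \<in> \<A> \<Longrightarrow> F - {x} \<in> \<A>"
  shows "(\<Sum>F\<in>\<A>. (- 1 :: int) ^ card F) = 0"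
proof -
  define \<B> where "\<B> = {F \<in> \<A>. x \<notin> F}"
  have "F \<in> \<B> \<union> insert x ` \<B>" if F: "F \<in> \<A>" for F
  proof (cases "x \<in> F")
    case True
    then have "F = insert x (F - {x})" by blast
    then show ?thesis using del[OF F] unfolding \<B>_def by blast
  next
    case False
    then show ?thesis using F unfolding \<B>_def by simp
  qed
  then have A: "\<A> = \<B> \<union> insert x ` \<B>" using ins unfolding \<B>_def by blast
  have "inj_on (insert x) \<B>" unfolding \<B>_def inj_on_def by (auto simp: insert_ident)
  then have "(\<Sum>F\<in>insert x ` \<B>. (- 1 :: int) ^ card F) = (\<Sum>F\<in>\<B>. (- 1) ^ card (insert x F))"
    by (simp add: sum.reindex)
  also have "\<dots> = - (\<Sum>F\<in>\<B>. (- 1) ^ card F)"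
    unfolding sum_negf[symmetric] by (rule sum.cong) (use fin(2) in \<open>auto simp: \<B>_def\<close>)
  finally show ?thesis
    unfolding A by (subst sum.union_disjoint) (use fin(1) in \<open>auto simp: \<B>_def\<close>)
qed

definition spans_edge :: "('v, 'z) sgraph_scheme \<Rightarrow> 'v set \<Rightarrow> bool" where
  "spans_edge G S \<longleftrightarrow> (\<exists>e\<in>edges G. e \<subseteq> S)"

definition edge_sets :: "('v, 'z) sgraph_scheme \<Rightarrow> 'v set \<Rightarrow> 'v set set" where
  "edge_sets G A = {S. S \<subseteq> A \<and> spans_edge G S}"

definition laminar :: "'a set set \<Rightarrow> bool" where
  "laminar F \<longleftrightarrow> (\<forall>X\<in>F. \<forall>Y\<in>F. X \<subseteq> Y \<or> Y \<subseteq> X \<or> X \<inter> Y = {})"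

definition laminar_subfamilies :: "'a set set \<Rightarrow> 'a set set set" where
  "laminar_subfamilies \<S> = {F. F \<subseteq> \<S> \<and> laminar F}"

definition signed_count :: "'a set set \<Rightarrow> int" where
  "signed_count \<S> = (\<Sum>F\<in>laminar_subfamilies \<S>. (- 1) ^ card F)"

lemma finite_edge_sets: "finite A \<Longrightarrow> finite (edge_sets G A)"
  unfolding edge_sets_def by simp

lemma finite_laminar_subfamilies: "finite \<S> \<Longrightarrow> finite (laminar_subfamilies \<S>)"
  unfolding laminar_subfamilies_def by simp

lemma laminar_subset: "laminar F \<Longrightarrow> F' \<subseteq> F \<Longrightarrow> laminar F'"
  unfolding laminar_def by blast

lemma laminar_Un:
  assumes "laminar F1" "laminar F2" "\<And>X Y. X \<in> F1 \<Longrightarrow> Y \<in> F2 \<Longrightarrow> X \<inter> Y = {}"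
  shows "laminar (F1 \<union> F2)"
  unfolding laminar_def
proof (intro ballI)
  fix X Y assume "X \<in> F1 \<union> F2" "Y \<in> F1 \<union> F2"
  then show "X \<subseteq> Y \<or> Y \<subseteq> X \<or> X \<inter> Y = {}"
    using assms(1,2) assms(3)[of X Y] assms(3)[of Y X] unfolding laminar_def
    by (elim UnE) (simp_all add: Int_commute)
qed

lemma laminar_insert:
  assumes "laminar F" "\<And>X. X \<in> F \<Longrightarrow> X \<subseteq> T \<or> T \<subseteq> X \<or> X \<inter> T = {}"
  shows "laminar (insert T F)"
  using assms unfolding laminar_def by (auto simp: Int_commute)

lemma spans_edge_nonempty:
  assumes "finite_simple_graph G" "spans_edge G S"
  shows "S \<noteq> {}"
  using assms unfolding finite_simple_graph_def spans_edge_def by fastforce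

lemma not_spans_edge_singleton:
  assumes "finite_simple_graph G"
  shows "\<not> spans_edge G {v}"
proof
  assume "spans_edge G {v}"
  then obtain e where "e \<in> edges G" "e \<subseteq> {v}" unfolding spans_edge_def by blast
  then have "card e = 2" "card e \<le> card {v}"
    using assms card_mono[of "{v}" e] unfolding finite_simple_graph_def by auto
  then show False by simp
qed

text \<open>If the whole set spans an edge, adding or removing it is a sign-reversing involution.\<close>

lemma signed_count_edge_sets:
  assumes "finite A"
  shows "signed_count (edge_sets G A) = (if spans_edge G A then 0 else 1)"
proof (cases "spans_edge G A")
  case True
  have "signed_count (edge_sets G A) = 0"
    unfolding signed_count_def
  proof (rule sum_minus_one_card_toggle)
    show "finite (laminar_subfamilies (edge_sets G A))"
      by (intro finite_laminar_subfamilies finite_edge_sets assms)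
  next
    fix F assume F: "F \<in> laminar_subfamilies (edge_sets G A)"
    show "finite F"
      using F finite_edge_sets[OF assms] finite_subset unfolding laminar_subfamilies_def by blast
    show "insert A F \<in> laminar_subfamilies (edge_sets G A)"
      using F True unfolding laminar_subfamilies_def laminar_def edge_sets_def by auto
    show "F - {A} \<in> laminar_subfamilies (edge_sets G A)"
      using F unfolding laminar_subfamilies_def laminar_def by auto
  qed
  with True show ?thesis by simp
next
  case False
  then have "edge_sets G A = {}" unfolding edge_sets_def spans_edge_def by blast
  then have "laminar_subfamilies (edge_sets G A) = {{}}"
    unfolding laminar_subfamilies_def laminar_def by auto
  with False show ?thesis by (simp add: signed_count_def)
qed

text \<open>Members of a laminar family that share \<open>q\<close> are pairwise comparable, so they
  form a chain, and the union of a finite nonempty chain is its largest member.\<close>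

lemma Union_mem_laminar:
  assumes "finite F" "laminar F" "F \<noteq> {}" "\<And>X. X \<in> F \<Longrightarrow> q \<in> X"
  shows "\<Union>F \<in> F"
proof (rule Union_in_chain[OF assms(1) assms(3)])
  show "subset.chain UNIV F"
    using assms(2,4) unfolding subset.chain_def laminar_def by blast
qed

text \<open>Once \<open>T\<close> is the largest member containing \<open>q\<close>, no other member
  can contain \<open>T\<close>; laminarity leaves it strictly inside \<open>T\<close> or disjoint
  from \<open>T\<close>. The two parts can be chosen independently, since sets from different parts
  are disjoint.\<close>

lemma laminar_fibre_bij:
  assumes A: "finite A" and T: "T \<subset> A" "q \<in> T" "spans_edge G T" and G: "finite_simple_graph G"
  shows "bij_betw (\<lambda>(F1, F2). insert T (F1 \<union> F2))
    (laminar_subfamilies (edge_sets G T - {T}) \<times> laminar_subfamilies (edge_sets G (A - T)))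
    {F \<in> laminar_subfamilies (edge_sets G A - {A}). insert q (\<Union>{S\<in>F. q \<in> S}) = T}"
    (is "bij_betw ?h (?X \<times> ?Y) ?Z")
proof (rule bij_betw_byWitness[where f' = "\<lambda>F. ({S\<in>F. S \<subset> T}, {S\<in>F. S \<inter> T = {}})"])
  \<comment> \<open>The empty set would pass both filters of the inverse map; members that span an
    edge are nonempty, so the two parts separate.\<close>
  have ne: "S \<noteq> {}" if "spans_edge G S" for S using spans_edge_nonempty[OF G that] .
  show "\<forall>x\<in>?X \<times> ?Y. ({S\<in>?h x. S \<subset> T}, {S\<in>?h x. S \<inter> T = {}}) = x"
    using ne T(2) unfolding laminar_subfamilies_def edge_sets_def by fastforce
  have mem: "T \<in> F" if F: "F \<in> ?Z" for F
  proof -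
    let ?C = "{S\<in>F. q \<in> S}"
    \<comment> \<open>Without a member containing \<open>q\<close> the index would be
      \<open>{q}\<close>, which spans no edge, contrary to the hypothesis on
      \<open>T\<close>.\<close>
    have "?C \<noteq> {}"
    proof
      assume "?C = {}"
      then have "T = {q}" using F by auto
      then show False using T(3) not_spans_edge_singleton[OF G] by blast
    qed
    moreover have "finite ?C"
      using F finite_edge_sets[OF A, of G] unfolding laminar_subfamilies_def
      by (auto intro: finite_subset)
    moreover have "laminar ?C"
      using F laminar_subset[of F ?C] unfolding laminar_subfamilies_def by auto
    ultimately have "\<Union>?C \<in> ?C" by (intro Union_mem_laminar[of _ q]) auto
    moreover have "\<Union>?C = T" using F T(2) \<open>?C \<noteq> {}\<close> by blast
    ultimately show ?thesis by simp
  qed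
  have split: "S = T \<or> S \<subset> T \<or> S \<inter> T = {}" if F: "F \<in> ?Z" and S: "S \<in> F" for F S
  proof -
    have "S \<subseteq> T" if "q \<in> S" using F S that by blast
    moreover have "S \<subseteq> T \<or> T \<subseteq> S \<or> S \<inter> T = {}"
      using mem[OF F] F S unfolding laminar_subfamilies_def laminar_def by simp
    ultimately show ?thesis using T(2) by blast
  qed
  show "\<forall>F\<in>?Z. ?h ({S\<in>F. S \<subset> T}, {S\<in>F. S \<inter> T = {}}) = F"
  proof
    fix F assume F: "F \<in> ?Z"
    show "?h ({S\<in>F. S \<subset> T}, {S\<in>F. S \<inter> T = {}}) = F"
      using mem[OF F] split[OF F] by auto
  qed
  show "?h ` (?X \<times> ?Y) \<subseteq> ?Z"
  proof (clarify, intro conjI)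
    fix F1 F2 assume F: "F1 \<in> ?X" "F2 \<in> ?Y"
    have s1: "S \<subset> T \<and> spans_edge G S" if "S \<in> F1" for S
      using F(1) that unfolding laminar_subfamilies_def edge_sets_def by blast
    have s2: "S \<subseteq> A - T \<and> spans_edge G S" if "S \<in> F2" for S
      using F(2) that unfolding laminar_subfamilies_def edge_sets_def by blast
    have "laminar F1" "laminar F2" using F unfolding laminar_subfamilies_def by auto
    then have "laminar (F1 \<union> F2)"
      by (rule laminar_Un) (use s1 s2 in blast)
    then have "laminar (insert T (F1 \<union> F2))"
      by (rule laminar_insert) (use s1 s2 in blast)
    moreover have "insert T (F1 \<union> F2) \<subseteq> edge_sets G A - {A}"
      using s1 s2 T unfolding edge_sets_def by blast
    ultimately show "insert T (F1 \<union> F2) \<in> laminar_subfamilies (edge_sets G A - {A})"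
      unfolding laminar_subfamilies_def by simp
    show "insert q (\<Union>{S\<in>insert T (F1 \<union> F2). q \<in> S}) = T"
      using s1 s2 T(2) by blast
  qed
  show "(\<lambda>F. ({S\<in>F. S \<subset> T}, {S\<in>F. S \<inter> T = {}})) ` ?Z \<subseteq> ?X \<times> ?Y"
  proof (intro image_subsetI SigmaI)
    fix F assume "F \<in> ?Z"
    then have F: "F \<subseteq> edge_sets G A - {A}" "laminar F" unfolding laminar_subfamilies_def by auto
    show "{S\<in>F. S \<subset> T} \<in> ?X"
      using F(1) laminar_subset[OF F(2), of "{S\<in>F. S \<subset> T}"]
      unfolding laminar_subfamilies_def edge_sets_def by auto
    show "{S\<in>F. S \<inter> T = {}} \<in> ?Y"
      using F(1) laminar_subset[OF F(2), of "{S\<in>F. S \<inter> T = {}}"]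
      unfolding laminar_subfamilies_def edge_sets_def by auto
  qed
qed

text \<open>Sort the laminar families by their largest member containing \<open>q\<close>; the index \<open>T = {q}\<close>
  stands for the families without such a member.\<close>

lemma signed_count_recurrence:
  assumes G: "finite_simple_graph G" and A: "finite A" "q \<in> A" "A \<noteq> {q}"
    and q: "\<And>v. v \<in> A - {q} \<Longrightarrow> {q, v} \<in> edges G"
  shows "signed_count (edge_sets G A - {A}) =
    (\<Sum>T | q \<in> T \<and> T \<subset> A. (if T = {q} then 1 else - signed_count (edge_sets G T - {T})) *
       (if spans_edge G (A - T) then 0 else 1))"
proof -
  let ?F = "laminar_subfamilies (edge_sets G A - {A})"
  let ?t = "\<lambda>F. insert q (\<Union>{S\<in>F. q \<in> S})"
  let ?I = "{T. q \<in> T \<and> T \<subset> A}"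
  have finF: "finite ?F" by (intro finite_laminar_subfamilies finite_Diff finite_edge_sets A)
  have finI: "finite ?I" by (rule finite_subset[of _ "Pow A"]) (use A(1) in auto)
  \<comment> \<open>The index is a proper subset of \<open>A\<close>: it is either
    \<open>{q}\<close> or a member of the family, and \<open>A\<close> is barred from
    membership.\<close>
  have "?t ` ?F \<subseteq> ?I"
  proof (intro image_subsetI)
    fix F assume F: "F \<in> ?F"
    let ?C = "{S\<in>F. q \<in> S}"
    show "?t F \<in> ?I"
    proof (cases "?C = {}")
      case True
      have "?t F = {q}" unfolding True by simp
      then show ?thesis using A by auto
    next
      case False
      have "finite ?C"
        using F finite_edge_sets[OF A(1), of G] unfolding laminar_subfamilies_def
        by (auto intro: finite_subset)
      moreover have "laminar ?C"
        using F laminar_subset[of F ?C] unfolding laminar_subfamilies_def by auto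
      ultimately have "\<Union>?C \<in> ?C" using False by (intro Union_mem_laminar[of _ q]) auto
      then have "\<Union>?C \<in> edge_sets G A - {A}" "q \<in> \<Union>?C"
        using F unfolding laminar_subfamilies_def by blast+
      then show ?thesis unfolding edge_sets_def by blast
    qed
  qed
  then have "signed_count (edge_sets G A - {A}) =
      (\<Sum>T\<in>?I. \<Sum>F | F \<in> ?F \<and> ?t F = T. (- 1) ^ card F)"
    unfolding signed_count_def by (rule sum.group[OF finF finI, symmetric])
  also have "\<dots> = (\<Sum>T\<in>?I. (if T = {q} then 1 else - signed_count (edge_sets G T - {T})) *
       signed_count (edge_sets G (A - T)))"
  proof (rule sum.cong[OF refl])
    fix T assume T: "T \<in> ?I"
    show "(\<Sum>F | F \<in> ?F \<and> ?t F = T. (- 1) ^ card F) =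
      (if T = {q} then 1 else - signed_count (edge_sets G T - {T})) *
       signed_count (edge_sets G (A - T))"
    proof (cases "T = {q}")
      case True
      \<comment> \<open>With no member containing \<open>q\<close>, the members form an arbitrary
        laminar family on \<open>A - {q}\<close>: the barred set \<open>A\<close> is no longer a
        candidate.\<close>
      have "{F. F \<in> ?F \<and> ?t F = T} = laminar_subfamilies (edge_sets G (A - T))"
      proof (intro set_eqI iffI)
        fix F assume "F \<in> {F. F \<in> ?F \<and> ?t F = T}"
        then have F: "F \<subseteq> edge_sets G A - {A}" "laminar F" "?t F = {q}"
          using True unfolding laminar_subfamilies_def by auto
        have "q \<notin> S" if "S \<in> F" for S
        proof
          assume "q \<in> S"
          then have "S = {q}" using F(3) that by blast
          then show False
            using F(1) that not_spans_edge_singleton[OF G] unfolding edge_sets_def by blast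
        qed
        then show "F \<in> laminar_subfamilies (edge_sets G (A - T))"
          using F(1,2) True unfolding laminar_subfamilies_def edge_sets_def by blast
      next
        fix F assume F: "F \<in> laminar_subfamilies (edge_sets G (A - T))"
        then have "q \<notin> S" if "S \<in> F" for S
          using that True unfolding laminar_subfamilies_def edge_sets_def by blast
        then show "F \<in> {F. F \<in> ?F \<and> ?t F = T}"
          using F True A(2) unfolding laminar_subfamilies_def edge_sets_def by blast
      qed
      then show ?thesis using True by (simp add: signed_count_def)
    next
      case False
      \<comment> \<open>Here the adjacency of \<open>q\<close> to the rest of \<open>A\<close>
        enters: a set with \<open>q\<close> and a second point spans an edge, so every such
        \<open>T\<close> is a possible member.\<close>
      then obtain v where "v \<in> T" "v \<noteq> q" using T by blast
      then have span: "spans_edge G T"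
        using T q[of v] unfolding spans_edge_def by (intro bexI[of _ "{q, v}"]) auto
      let ?X = "laminar_subfamilies (edge_sets G T - {T})"
      let ?Y = "laminar_subfamilies (edge_sets G (A - T))"
      have TA: "T \<subset> A" "q \<in> T" using T by auto
      \<comment> \<open>The extra member \<open>T\<close> itself contributes the minus sign of the
        recurrence.\<close>
      have card: "card (insert T (F1 \<union> F2)) = Suc (card F1 + card F2)"
        if "F1 \<in> ?X" "F2 \<in> ?Y" for F1 F2
      proof -
        have F: "F1 \<subseteq> edge_sets G T - {T}" "F2 \<subseteq> edge_sets G (A - T)"
          using that unfolding laminar_subfamilies_def by auto
        have "finite T" using A(1) TA(1) finite_subset by blast
        then have fin: "finite F1" "finite F2"
          using F A(1) finite_edge_sets[of T G] finite_edge_sets[of "A - T" G]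
          by (meson finite_Diff finite_subset)+
        have "F1 \<inter> F2 = {}"
          using F spans_edge_nonempty[OF G] unfolding edge_sets_def by blast
        moreover have "T \<notin> F1 \<union> F2" using F TA unfolding edge_sets_def by blast
        ultimately show ?thesis using fin by (simp add: card_Un_disjoint)
      qed
      have "(\<Sum>F | F \<in> ?F \<and> ?t F = T. (- 1 :: int) ^ card F) =
          (\<Sum>(F1, F2)\<in>?X \<times> ?Y. (- 1) ^ card (insert T (F1 \<union> F2)))"
        using sum.reindex_bij_betw[OF laminar_fibre_bij[OF A(1) TA span G],
            of "\<lambda>F. (- 1 :: int) ^ card F"]
        by (simp add: case_prod_unfold)
      also have "\<dots> = (\<Sum>(F1, F2)\<in>?X \<times> ?Y. - ((- 1) ^ card F1 * (- 1) ^ card F2))"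
        by (rule sum.cong) (auto simp: card power_add)
      also have "\<dots> = - (signed_count (edge_sets G T - {T}) * signed_count (edge_sets G (A - T)))"
        unfolding signed_count_def sum_product sum.cartesian_product sum_negf[symmetric]
        by (simp add: case_prod_unfold)
      finally show ?thesis using False by simp
    qed
  qed
  also have "\<dots> = (\<Sum>T\<in>?I. (if T = {q} then 1 else - signed_count (edge_sets G T - {T})) *
       (if spans_edge G (A - T) then 0 else 1))"
    using A(1) by (intro sum.cong[OF refl]) (simp add: signed_count_edge_sets)
  finally show ?thesis .
qed

section \<open>Acyclic orientations\<close>

definition sources :: "'v set \<Rightarrow> ('v \<times> 'v) set \<Rightarrow> 'v set" where
  "sources N D = {v \<in> N. \<forall>u. (u, v) \<notin> D}"

lemma orientation_induced_subgraph_iff: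
  "orientation (induced_subgraph G N) D \<longleftrightarrow>
     (\<forall>u v. (u, v) \<in> D \<longrightarrow> {u, v} \<in> edges G \<and> u \<in> N \<and> v \<in> N) \<and>
     (\<forall>u v. {u, v} \<in> edges G \<and> u \<in> N \<and> v \<in> N \<longrightarrow> ((u, v) \<in> D \<longleftrightarrow> (v, u) \<notin> D))"
  unfolding orientation_def induced_subgraph_def
  by (simp only: sgraph.simps mem_Collect_eq insert_subset empty_subsetI simp_thms
      Ball_def split_paired_All prod.case)

lemma finite_acyclic_orientations:
  assumes "finite N"
  shows "finite (acyclic_orientations (induced_subgraph G N))"
proof (rule finite_subset)
  show "acyclic_orientations (induced_subgraph G N) \<subseteq> Pow (N \<times> N)"
    unfolding acyclic_orientations_def orientation_induced_subgraph_iff by auto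
qed (use assms in simp)

lemma sources_independent:
  assumes G: "finite_simple_graph G" and D: "orientation (induced_subgraph G N) D"
    and S: "S \<subseteq> sources N D"
  shows "\<not> spans_edge G S"
proof
  assume "spans_edge G S"
  then obtain e where e: "e \<in> edges G" "e \<subseteq> S" unfolding spans_edge_def by blast
  then obtain u v where "e = {u, v}"
    using G unfolding finite_simple_graph_def by (metis card_2_iff)
  then have "{u, v} \<in> edges G" "u \<in> N" "v \<in> N" "(u, v) \<notin> D" "(v, u) \<notin> D"
    using e S unfolding sources_def by auto
  with D show False unfolding orientation_induced_subgraph_iff by metis
qed

text \<open>When all of \<open>S\<close> are sources, every edge meeting \<open>S\<close> must point
  out of \<open>S\<close>, and independence leaves no edge inside \<open>S\<close> to decide. The
  orientation is therefore determined by its restriction to \<open>N - S\<close>; conversely, adding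
  the forced arcs \<open>?out\<close> creates no cycle, because nothing enters
  \<open>S\<close>.\<close>

lemma acyclic_orientations_sources_bij:
  fixes G :: "'v sgraph"
  assumes S: "S \<subseteq> N" "\<not> spans_edge G S"
  shows "bij_betw (\<lambda>D. D \<inter> (N - S) \<times> (N - S))
    {D \<in> acyclic_orientations (induced_subgraph G N). S \<subseteq> sources N D}
    (acyclic_orientations (induced_subgraph G (N - S)))"
    (is "bij_betw ?r ?X ?Y")
proof -
  let ?out = "{(s, t). s \<in> S \<and> t \<in> N \<and> {s, t} \<in> edges G}"
  have indep: "{s, t} \<notin> edges G" if "s \<in> S" "t \<in> S" for s t
    using that S(2) unfolding spans_edge_def by auto
  show ?thesis
  proof (rule bij_betw_byWitness[where f' = "\<lambda>D. D \<union> ?out"])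
    show "\<forall>D\<in>?X. ?r D \<union> ?out = D"
    proof
      fix D assume "D \<in> ?X"
      then have D: "orientation (induced_subgraph G N) D" "S \<subseteq> sources N D"
        unfolding acyclic_orientations_def by auto
      have "(u, v) \<in> D" if "(u, v) \<in> ?out" for u v
        using that D S(1) unfolding orientation_induced_subgraph_iff sources_def by blast
      moreover have "(u, v) \<in> ?r D \<union> ?out" if "(u, v) \<in> D" for u v
        using that D unfolding orientation_induced_subgraph_iff sources_def by blast
      ultimately show "?r D \<union> ?out = D" by auto
    qed
    show "\<forall>D\<in>?Y. ?r (D \<union> ?out) = D"
    proof
      fix D assume "D \<in> ?Y"
      then have "D \<subseteq> (N - S) \<times> (N - S)"
        unfolding acyclic_orientations_def orientation_induced_subgraph_iff by auto
      then show "?r (D \<union> ?out) = D" by blast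
    qed
    show "?r ` ?X \<subseteq> ?Y"
    proof
      fix D' assume "D' \<in> ?r ` ?X"
      then obtain D where D: "D' = ?r D" "orientation (induced_subgraph G N) D" "acyclic D"
        unfolding acyclic_orientations_def by auto
      have "acyclic D'" using D(1,3) acyclic_subset by blast
      moreover have "orientation (induced_subgraph G (N - S)) D'"
        using D(1,2) unfolding orientation_induced_subgraph_iff by blast
      ultimately show "D' \<in> ?Y" unfolding acyclic_orientations_def by simp
    qed
    show "(\<lambda>D. D \<union> ?out) ` ?Y \<subseteq> ?X"
    proof (intro image_subsetI)
      fix D assume "D \<in> ?Y"
      then have D: "orientation (induced_subgraph G (N - S)) D" "acyclic D"
        unfolding acyclic_orientations_def by auto
      have tgt: "v \<notin> S" if "(u, v) \<in> D \<union> ?out" for u v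
        using that D(1) indep unfolding orientation_induced_subgraph_iff by blast
      \<comment> \<open>A path of the extended orientation that starts outside \<open>S\<close> uses
        only arcs of \<open>D\<close>, and a cycle through \<open>S\<close> would have to enter
        \<open>S\<close>.\<close>
      have "(x, y) \<in> D\<^sup>+ \<and> y \<notin> S" if "(x, y) \<in> (D \<union> ?out)\<^sup>+" "x \<notin> S" for x y
        using that
      proof (induction rule: trancl_induct)
        case (base y)
        then show ?case using tgt by blast
      next
        case (step y z)
        then have "(y, z) \<in> D" by blast
        then show ?case using step tgt[of y z] by (blast intro: trancl_into_trancl)
      qed
      moreover have "x \<notin> S" if "(y, x) \<in> (D \<union> ?out)\<^sup>+" for x y
        using tranclD2[OF that] tgt by blast
      ultimately have acyc: "acyclic (D \<union> ?out)"
        using D(2) unfolding acyclic_def by blast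
      have key: "(s, t) \<in> D \<union> ?out \<and> (t, s) \<notin> D \<union> ?out"
        if "s \<in> S" "t \<in> N" "{s, t} \<in> edges G" for s t
        using that tgt[of t s] by blast
      have "orientation (induced_subgraph G N) (D \<union> ?out)"
        unfolding orientation_induced_subgraph_iff
      proof (intro conjI allI impI)
        fix u v
        assume uv: "{u, v} \<in> edges G \<and> u \<in> N \<and> v \<in> N"
        show "(u, v) \<in> D \<union> ?out \<longleftrightarrow> (v, u) \<notin> D \<union> ?out"
        proof (cases "u \<in> S \<or> v \<in> S")
          case True
          then show ?thesis
            using uv key[of u v] key[of v u] by (auto simp only: insert_commute)
        next
          case False
          then have "(u, v) \<in> D \<union> ?out \<longleftrightarrow> (u, v) \<in> D" "(v, u) \<in> D \<union> ?out \<longleftrightarrow> (v, u) \<in> D"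
            by auto
          moreover have "(u, v) \<in> D \<longleftrightarrow> (v, u) \<notin> D"
            using uv False
            by (intro D(1)[unfolded orientation_induced_subgraph_iff, THEN conjunct2, rule_format])
              simp
          ultimately show ?thesis by (simp only:)
        qed
      next
        fix u v assume "(u, v) \<in> D \<union> ?out"
        then show "{u, v} \<in> edges G" "u \<in> N" "v \<in> N"
          using D(1)[unfolded orientation_induced_subgraph_iff, THEN conjunct1] S(1) by auto
      qed
      moreover have "S \<subseteq> sources N (D \<union> ?out)"
        using S(1) tgt unfolding sources_def by blast
      ultimately show "D \<union> ?out \<in> ?X" using acyc unfolding acyclic_orientations_def by simp
    qed
  qed
qed

text \<open>An acyclic orientation of \<open>T\<close> with \<open>N - T\<close> independent amounts to an acyclic orientation
  of \<open>N\<close> in which all of \<open>N - T\<close> are sources. For a fixed orientation of \<open>N\<close> the alternating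
  sum over subsets of its nonempty set of sources vanishes.\<close>

lemma alternating_sum_acyclic_orientations:
  fixes G :: "'v sgraph"
  assumes G: "finite_simple_graph G" and N: "finite N" "N \<noteq> {}"
  shows "(\<Sum>T\<in>Pow N. (- 1) ^ card T * int (card (acyclic_orientations (induced_subgraph G T))) *
      (if spans_edge G (N - T) then 0 else 1)) = 0"
proof -
  let ?AO = "\<lambda>N. acyclic_orientations (induced_subgraph G N)"
  have "(\<Sum>T\<in>Pow N. (- 1) ^ card T * int (card (?AO T)) * (if spans_edge G (N - T) then 0 else 1))
    = (\<Sum>T\<in>Pow N. (- 1) ^ card T * int (card {D \<in> ?AO N. N - T \<subseteq> sources N D}))"
  proof (rule sum.cong[OF refl])
    fix T assume "T \<in> Pow N"
    then have T: "N - (N - T) = T" by blast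
    show "(- 1) ^ card T * int (card (?AO T)) * (if spans_edge G (N - T) then 0 else 1) =
        (- 1) ^ card T * int (card {D \<in> ?AO N. N - T \<subseteq> sources N D})"
    proof (cases "spans_edge G (N - T)")
      case True
      then have "{D \<in> ?AO N. N - T \<subseteq> sources N D} = {}"
        using sources_independent[OF G] unfolding acyclic_orientations_def by blast
      then have "card {D \<in> ?AO N. N - T \<subseteq> sources N D} = 0" by (simp only: card.empty)
      with True show ?thesis by simp
    next
      case False
      then show ?thesis
        using bij_betw_same_card[OF acyclic_orientations_sources_bij[of "N - T" N G]]
        by (simp add: T)
    qed
  qed
  also have "\<dots> = (\<Sum>T\<in>Pow N. \<Sum>D\<in>?AO N. if N - T \<subseteq> sources N D then (- 1) ^ card T else 0)"
    using finite_acyclic_orientations[OF N(1), of G]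
    by (intro sum.cong[OF refl]) (simp add: sum.If_cases Int_def mult.commute)
  also have "\<dots> = (\<Sum>D\<in>?AO N. \<Sum>T\<in>Pow N. if N - T \<subseteq> sources N D then (- 1) ^ card T else 0)"
    by (rule sum.swap)
  also have "\<dots> = 0"
  proof (rule sum.neutral, rule ballI)
    fix D assume "D \<in> ?AO N"
    then have D: "D \<subseteq> N \<times> N" "acyclic D"
      unfolding acyclic_orientations_def orientation_induced_subgraph_iff by auto
    \<comment> \<open>A finite acyclic relation is well-founded, so the nonempty \<open>N\<close>
      has a minimal vertex \<open>x\<close>, which is a source.\<close>
    then have "wf D" using N(1) finite_acyclic_wf finite_subset by blast
    then obtain x where "x \<in> N" "\<And>y. (y, x) \<in> D \<Longrightarrow> y \<notin> N"
      using N(2) unfolding wf_eq_minimal by blast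
    then have x: "x \<in> N" "x \<in> sources N D" using D(1) unfolding sources_def by auto
    have "(\<Sum>T\<in>Pow N. if N - T \<subseteq> sources N D then (- 1) ^ card T else 0) =
      (\<Sum>T\<in>{T \<in> Pow N. N - T \<subseteq> sources N D}. (- 1 :: int) ^ card T)"
      using N(1) by (intro sum.inter_filter[symmetric]) simp
    also have "\<dots> = 0"
    \<comment> \<open>Since \<open>x\<close> is a source, its membership in \<open>T\<close> does
      not affect \<open>N - T \<subseteq> sources N D\<close>; toggling \<open>x\<close> in
      \<open>T\<close> cancels the sum.\<close>
    proof (rule sum_minus_one_card_toggle[where x = x])
    qed (use x N(1) in \<open>auto intro: finite_subset\<close>)
    finally show "(\<Sum>T\<in>Pow N. if N - T \<subseteq> sources N D then (- 1 :: int) ^ card T else 0) = 0" .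
  qed
  finally show ?thesis .
qed

lemma acyclic_orientations_empty: "acyclic_orientations (induced_subgraph G {}) = {{}}"
proof -
  have "orientation (induced_subgraph G {}) D \<longleftrightarrow> D = {}" for D
    unfolding orientation_induced_subgraph_iff by auto
  then show ?thesis unfolding acyclic_orientations_def by (auto intro: wf_acyclic)
qed

text \<open>Strong induction on \<open>N\<close>: the left side obeys
  \<open>signed_count_recurrence\<close>, re-indexed from sets \<open>insert q T\<close> to
  \<open>T\<close>; the right side obeys the same recurrence, obtained by solving the vanishing
  alternating sum for its term \<open>T = N\<close>.\<close>

lemma signed_count_cone:
  fixes G :: "'v sgraph"
  assumes G: "finite_simple_graph G" and N: "finite N" "q \<notin> N"
    and q: "\<And>v. v \<in> N \<Longrightarrow> {q, v} \<in> edges G"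
  shows "(if N = {} then 1 else - signed_count (edge_sets G (insert q N) - {insert q N})) =
    (- 1) ^ card N * int (card (acyclic_orientations (induced_subgraph G N)))"
  using N q
proof (induction N rule: finite_psubset_induct)
  case (psubset N)
  let ?w = "\<lambda>N. if N = {} then 1 else - signed_count (edge_sets G (insert q N) - {insert q N})"
  let ?a = "\<lambda>N. (- 1) ^ card N * int (card (acyclic_orientations (induced_subgraph G N)))"
  let ?i = "\<lambda>T. if spans_edge G (N - T) then 0 else 1 :: int"
  show ?case
  proof (cases "N = {}")
    case True
    then show ?thesis using acyclic_orientations_empty[of G] by simp
  next
    case False
    have bij: "bij_betw (insert q) {T. T \<subset> N} {T. q \<in> T \<and> T \<subset> insert q N}"
      by (rule bij_betw_byWitness[where f' = "\<lambda>T. T - {q}"]) (use psubset.prems(1) in auto)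
    have "signed_count (edge_sets G (insert q N) - {insert q N}) =
      (\<Sum>T | q \<in> T \<and> T \<subset> insert q N.
        (if T = {q} then 1 else - signed_count (edge_sets G T - {T})) *
        (if spans_edge G (insert q N - T) then 0 else 1))"
      by (rule signed_count_recurrence[OF G]) (use psubset False in auto)
    also have "\<dots> = (\<Sum>T | T \<subset> N. ?w T * ?i T)"
      unfolding sum.reindex_bij_betw[OF bij, symmetric]
    proof (rule sum.cong[OF refl])
      fix T assume "T \<in> {T. T \<subset> N}"
      then have "q \<notin> T" "insert q N - insert q T = N - T" using psubset.prems(1) by auto
      moreover from this have "insert q T = {q} \<longleftrightarrow> T = {}" by blast
      ultimately show "(if insert q T = {q} then 1
          else - signed_count (edge_sets G (insert q T) - {insert q T})) *
        (if spans_edge G (insert q N - insert q T) then 0 else 1) = ?w T * ?i T" by simp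
    qed
    also have "\<dots> = (\<Sum>T | T \<subset> N. ?a T * ?i T)"
    proof (rule sum.cong[OF refl])
      fix T assume T: "T \<in> {T. T \<subset> N}"
      have "?w T = ?a T" by (rule psubset.IH) (use T psubset.prems in auto)
      then show "?w T * ?i T = ?a T * ?i T" by simp
    qed
    \<comment> \<open>The added term has coefficient 1, since \<open>N - N\<close> is empty and
      spans no edge; the completed sum vanishes.\<close>
    also have "\<dots> = (\<Sum>T\<in>Pow N. ?a T * ?i T) - ?a N * ?i N"
    proof -
      have "Pow N = insert N {T. T \<subset> N}" by auto
      moreover have "finite {T. T \<subset> N}"
        by (rule finite_subset[of _ "Pow N"]) (use psubset.hyps in auto)
      ultimately show ?thesis by simp
    qed
    also have "\<dots> = - ?a N"
      using alternating_sum_acyclic_orientations[OF G psubset.hyps(1) False]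
        spans_edge_nonempty[OF G, of "{}"] by auto
    finally show ?thesis using False by simp
  qed
qed

section \<open>Trees as parent functions\<close>

text \<open>A shortest walk from \<open>u\<close> to \<open>v\<close> in the graph without the edge
  has distinct vertices, and the edge closes it to a cycle.\<close>

lemma bridge:
  assumes nc: "\<nexists>vs. is_cycle G vs" and e: "{u, v} \<in> edges G" "u \<noteq> v"
  shows "(u, v) \<notin> (adj_rel (delete_edge G {u, v}))\<^sup>*"
proof
  let ?R = "adj_rel (delete_edge G {u, v})"
  assume "(u, v) \<in> ?R\<^sup>*"
  then have ex: "\<exists>n. (u, v) \<in> ?R ^^ n" by (simp add: rtrancl_power)
  define n where "n = (LEAST n. (u, v) \<in> ?R ^^ n)"
  have n: "(u, v) \<in> ?R ^^ n" unfolding n_def by (rule LeastI_ex[OF ex])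
  have min: "n \<le> m" if "(u, v) \<in> ?R ^^ m" for m
    unfolding n_def using that by (rule Least_le)
  from n obtain f where f: "f 0 = u" "f n = v" "\<And>i. i < n \<Longrightarrow> (f i, f (Suc i)) \<in> ?R"
    unfolding relpow_fun_conv by blast
  have sub: "(f i, f j) \<in> ?R ^^ (j - i)" if "i \<le> j" "j \<le> n" for i j
    unfolding relpow_fun_conv
    by (rule exI[of _ "\<lambda>k. f (i + k)"]) (use that f(3) in auto)
  have "f i \<noteq> f j" if "i < j" "j \<le> n" for i j
  proof
    assume "f i = f j"
    then have "(u, f j) \<in> ?R ^^ i" "(f j, v) \<in> ?R ^^ (n - j)"
      using sub[of 0 i] sub[of j n] that f(1,2) by simp_all
    then have "(u, v) \<in> ?R ^^ (i + (n - j))" unfolding relpow_add by (rule relcompI)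
    then show False using min[of "i + (n - j)"] that by simp
  qed
  then have inj: "inj_on f {..n}"
    by (intro inj_onI) (metis atMost_iff linorder_neqE_nat)
  have edge: "{f i, f (Suc i)} \<in> edges G" if "i < n" for i
    using f(3)[OF that] by (simp add: adj_rel_def delete_edge_def)
  \<comment> \<open>Length 0 would identify \<open>u\<close> and \<open>v\<close>, and length 1
    would use the deleted edge; so the cycle has at least three vertices.\<close>
  have "n \<noteq> 0" using f(1,2) e(2) by (cases "n = 0") auto
  moreover have "n \<noteq> 1" using n by (auto simp: adj_rel_def delete_edge_def)
  ultimately have n2: "n \<ge> 2" by simp
  have "is_cycle G (map f [0..<Suc n])"
    unfolding is_cycle_def
  proof (intro conjI allI impI)
    show "distinct (map f [0..<Suc n])"
      using inj by (simp add: distinct_map atLeast0LessThan lessThan_Suc_atMost del: upt_Suc)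
    fix i assume i: "i < length (map f [0..<Suc n])"
    show "{map f [0..<Suc n] ! i, map f [0..<Suc n] ! (Suc i mod length (map f [0..<Suc n]))}
        \<in> edges G"
    proof (cases "i = n")
      case True
      then show ?thesis using f(1,2) e(1) by (simp add: insert_commute del: upt_Suc)
    next
      case False
      then have "i < n" using i by simp
      then show ?thesis using edge by (simp del: upt_Suc)
    qed
  qed (use n2 in simp)
  then show False using nc by blast
qed

text \<open>A tree rooted at \<open>r\<close>, given by a parent function \<open>p\<close> and any
  rank \<open>d\<close> that drops strictly towards the root. Acyclicity and reachability become
  arguments by descent on \<open>d\<close>, both for abstract trees (\<open>d\<close> is the
  distance to the root) and for Hasse trees (\<open>d\<close> counts missing labels).\<close>

locale parent_tree =
  fixes T :: "('v, 'z) sgraph_scheme" and r :: 'v and p :: "'v \<Rightarrow> 'v" and d :: "'v \<Rightarrow> nat"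
  assumes finite_verts: "finite (verts T)"
    and root: "r \<in> verts T"
    and parent_verts: "v \<in> verts T \<Longrightarrow> v \<noteq> r \<Longrightarrow> p v \<in> verts T"
    and parent_depth: "v \<in> verts T \<Longrightarrow> v \<noteq> r \<Longrightarrow> d (p v) < d v"
    and edges_eq: "edges T = (\<lambda>v. {v, p v}) ` (verts T - {r})"
begin

definition par :: "('v \<times> 'v) set" where
  "par = {(v, p v) |v. v \<in> verts T \<and> v \<noteq> r}"

lemma par_iff: "(u, v) \<in> par \<longleftrightarrow> u \<in> verts T \<and> u \<noteq> r \<and> v = p u"
  unfolding par_def by auto

lemma edge_iff: "{u, v} \<in> edges T \<longleftrightarrow> (u, v) \<in> par \<or> (v, u) \<in> par"
  unfolding edges_eq par_iff by (auto simp: doubleton_eq_iff)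

lemma inj_parent_edge: "inj_on (\<lambda>v. {v, p v}) (verts T - {r})"
proof (rule inj_onI)
  fix u v assume *: "u \<in> verts T - {r}" "v \<in> verts T - {r}" "{u, p u} = {v, p v}"
  then have "u = v \<or> (u = p v \<and> p u = v)" by (auto simp: doubleton_eq_iff)
  then show "u = v" using parent_depth[of u] parent_depth[of v] * by auto
qed

lemma par_rtrancl_depth: "(u, v) \<in> par\<^sup>* \<Longrightarrow> u = v \<or> d v < d u"
  by (induction rule: rtrancl_induct) (use parent_depth in \<open>fastforce simp: par_iff\<close>)+

lemma par_antisym: "(u, v) \<in> par\<^sup>* \<Longrightarrow> (v, u) \<in> par\<^sup>* \<Longrightarrow> u = v"
  using par_rtrancl_depth[of u v] par_rtrancl_depth[of v u] by auto

lemma par_linear: "(x, u) \<in> par\<^sup>* \<Longrightarrow> (x, v) \<in> par\<^sup>* \<Longrightarrow> (u, v) \<in> par\<^sup>* \<or> (v, u) \<in> par\<^sup>*"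
  by (rule single_valued_confluent) (auto simp: single_valued_def par_iff)

lemma par_root_rtrancl: "(r, v) \<in> par\<^sup>* \<Longrightarrow> v = r"
  by (erule converse_rtranclE) (auto simp: par_iff)

lemma par_rtrancl_step:
  assumes "(u, v) \<in> par\<^sup>*" "u \<noteq> v"
  shows "u \<in> verts T" "u \<noteq> r" "(p u, v) \<in> par\<^sup>*"
proof -
  obtain w where "(u, w) \<in> par" "(w, v) \<in> par\<^sup>*"
    using assms by (auto elim: converse_rtranclE)
  then show "u \<in> verts T" "u \<noteq> r" "(p u, v) \<in> par\<^sup>*" by (simp_all add: par_iff)
qed

lemma reaches_root: "v \<in> verts T \<Longrightarrow> (v, r) \<in> par\<^sup>*"
proof (induction "d v" arbitrary: v rule: less_induct)
  case less
  show ?case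
  proof (cases "v = r")
    case False
    then have "(v, p v) \<in> par" "(p v, r) \<in> par\<^sup>*"
      using less parent_verts parent_depth by (auto simp: par_iff)
    then show ?thesis by (rule converse_rtrancl_into_rtrancl)
  qed simp
qed

lemma finite_simple: "finite_simple_graph T"
  unfolding finite_simple_graph_def
proof (intro conjI ballI)
  fix e assume "e \<in> edges T"
  then obtain v where v: "v \<in> verts T" "v \<noteq> r" "e = {v, p v}" unfolding edges_eq by blast
  then show "e \<subseteq> verts T" using parent_verts by simp
  have "v \<noteq> p v" using parent_depth[OF v(1,2)] by auto
  then show "card e = 2" using v(3) by simp
qed (rule finite_verts)

lemma par_adj: "par\<^sup>* \<subseteq> (adj_rel T)\<^sup>*"
  by (rule rtrancl_mono) (auto simp: adj_rel_def edge_iff)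

lemma is_tree: "is_tree T"
  unfolding is_tree_def
proof (intro conjI notI)
  have "sym (adj_rel T)" unfolding sym_def adj_rel_def by (simp add: insert_commute)
  then have "sym ((adj_rel T)\<^sup>*)" by (rule sym_rtrancl)
  then have "(r, v) \<in> (adj_rel T)\<^sup>*" "(v, r) \<in> (adj_rel T)\<^sup>*" if "v \<in> verts T" for v
    using reaches_root[OF that] par_adj by (auto dest: symD)
  then show "connected_graph T"
    unfolding connected_graph_def using root by (blast intro: rtrancl_trans)
  assume "\<exists>vs. is_cycle T vs"
  then obtain vs where vs: "length vs \<ge> 3" "distinct vs"
    "\<And>i. i < length vs \<Longrightarrow> {vs ! i, vs ! (Suc i mod length vs)} \<in> edges T"
    unfolding is_cycle_def by blast
  let ?n = "length vs"
  \<comment> \<open>At a vertex of maximal rank on the cycle both neighbours have to be its parent,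
    so the cycle repeats a vertex.\<close>
  have "Max (d ` set vs) \<in> d ` set vs" using vs(1) by (intro Max_in) auto
  then obtain i where i: "i < ?n" "d (vs ! i) = Max (d ` set vs)"
    by (auto simp: in_set_conv_nth)
  then have max: "d (vs ! j) \<le> d (vs ! i)" if "j < ?n" for j using that by simp
  have nbr: "vs ! j = p (vs ! i)" if "j < ?n" "{vs ! i, vs ! j} \<in> edges T" for j
    using that max[OF that(1)] parent_depth[of "vs ! j"] unfolding edge_iff par_iff by auto
  \<comment> \<open>These are the cyclic successor and predecessor of \<open>i\<close>; they differ
    because the cycle has length at least 3.\<close>
  define j k where "j = Suc i mod ?n" and "k = (if i = 0 then ?n - 1 else i - 1)"
  have jk: "j < ?n" "k < ?n" "Suc k mod ?n = i" "j \<noteq> k"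
    using i(1) vs(1) unfolding j_def k_def by (auto simp: mod_Suc)
  have "vs ! j = p (vs ! i)" using vs(3)[OF i(1)] by (intro nbr jk) (simp add: j_def)
  moreover have "vs ! k = p (vs ! i)"
    using vs(3)[OF jk(2)] by (intro nbr jk) (simp add: jk insert_commute)
  ultimately show False using jk(1,2,4) vs(2) nth_eq_iff_index_eq by metis
qed (rule finite_simple)

text \<open>Each edge is indexed by its lower end: those at \<open>v\<close> come from the children
  of \<open>v\<close> and, unless \<open>v\<close> is the root, from \<open>v\<close>
  itself.\<close>

lemma degree_eq:
  assumes "v \<in> verts T"
  shows "degree T v = card {w \<in> verts T - {r}. p w = v} + (if v = r then 0 else 1)"
proof -
  let ?C = "{w \<in> verts T - {r}. p w = v}"
  let ?S = "?C \<union> (if v = r then {} else {v})"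
  have "{e \<in> edges T. v \<in> e} = (\<lambda>w. {w, p w}) ` ?S"
    unfolding edges_eq using assms by auto
  moreover have "inj_on (\<lambda>w. {w, p w}) ?S"
    by (rule inj_on_subset[OF inj_parent_edge]) (use assms in auto)
  ultimately have "degree T v = card ?S" unfolding degree_def by (simp add: card_image)
  moreover have "v \<notin> ?C" using parent_depth[of v] by auto
  ultimately show ?thesis using finite_verts by auto
qed

end

text \<open>Take the distance to \<open>r\<close> as \<open>d\<close> and a neighbour closer to
  \<open>r\<close> as \<open>p v\<close>. What needs acyclicity is that there are no edges besides
  the parent edges.\<close>

lemma is_tree_parent_tree:
  assumes T: "is_tree T" and r: "r \<in> verts T"
  obtains p d where "parent_tree T r p d"
proof -
  have fs: "finite_simple_graph T" and conn: "connected_graph T" and nc: "\<nexists>vs. is_cycle T vs"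
    using T unfolding is_tree_def by auto
  have two: "card e = 2" "e \<subseteq> verts T" if "e \<in> edges T" for e
    using fs that unfolding finite_simple_graph_def by auto
  define d where "d v = (LEAST n. (v, r) \<in> adj_rel T ^^ n)" for v
  have dI: "(v, r) \<in> adj_rel T ^^ d v" if "v \<in> verts T" for v
  proof -
    have "\<exists>n. (v, r) \<in> adj_rel T ^^ n"
      using conn that r unfolding connected_graph_def by (simp add: rtrancl_power[symmetric])
    then show ?thesis unfolding d_def by (rule LeastI_ex)
  qed
  have "\<exists>u. {v, u} \<in> edges T \<and> d u < d v" if v: "v \<in> verts T - {r}" for v
  proof -
    have vr: "(v, r) \<in> adj_rel T ^^ d v" using dI v by blast
    then obtain m where m: "d v = Suc m" using v by (cases "d v") auto
    then obtain u where "(v, u) \<in> adj_rel T" "(u, r) \<in> adj_rel T ^^ m"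
      using vr relpow_Suc_D2 by metis
    moreover from this(2) have "d u \<le> m" unfolding d_def by (rule Least_le)
    ultimately show ?thesis using m unfolding adj_rel_def by auto
  qed
  then obtain p where p: "\<And>v. v \<in> verts T - {r} \<Longrightarrow> {v, p v} \<in> edges T"
    "\<And>v. v \<in> verts T - {r} \<Longrightarrow> d (p v) < d v"
    by metis
  have pv: "p v \<in> verts T" if "v \<in> verts T - {r}" for v
    using two(2)[OF p(1)[OF that]] by simp
  \<comment> \<open>Any other edge could be deleted with every vertex still reaching
    \<open>r\<close> along parents, so its ends would stay connected, contradicting
    \<open>bridge\<close>.\<close>
  have "e \<in> (\<lambda>v. {v, p v}) ` (verts T - {r})" if e: "e \<in> edges T" for e
  proof (rule ccontr)
    assume ne: "e \<notin> (\<lambda>v. {v, p v}) ` (verts T - {r})"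
    let ?R = "adj_rel (delete_edge T e)"
    have step: "(v, p v) \<in> ?R" if "v \<in> verts T - {r}" for v
      using p(1)[OF that] ne that unfolding adj_rel_def delete_edge_def by auto
    have reach: "(v, r) \<in> ?R\<^sup>*" if "v \<in> verts T" for v
      using that
    proof (induction "d v" arbitrary: v rule: less_induct)
      case less
      show ?case
      proof (cases "v = r")
        case False
        then have "(p v, r) \<in> ?R\<^sup>*" using less p(2) pv by simp
        then show ?thesis
          using step[of v] False less.prems by (blast intro: converse_rtrancl_into_rtrancl)
      qed simp
    qed
    obtain u v where uv: "e = {u, v}" "u \<noteq> v" using two(1)[OF e] by (auto simp: card_2_iff)
    have "sym ?R" unfolding sym_def adj_rel_def by (simp add: insert_commute)
    then have "sym (?R\<^sup>*)" by (rule sym_rtrancl)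
    moreover have "(u, r) \<in> ?R\<^sup>*" "(v, r) \<in> ?R\<^sup>*" using reach two(2)[OF e] uv(1) by auto
    ultimately have "(u, v) \<in> ?R\<^sup>*" by (meson rtrancl_trans symD)
    then show False using bridge[OF nc, of u v] e uv by simp
  qed
  then have "edges T = (\<lambda>v. {v, p v}) ` (verts T - {r})" using p(1) by blast
  then have "parent_tree T r p d"
    using fs r p(2) pv by unfold_locales (auto simp: finite_simple_graph_def)
  then show thesis by (rule that)
qed

section \<open>The laminar family of a stable tree\<close>

text \<open>A tree with a distinguished leaf \<open>P\<close> is encoded by the sets of labels below its vertices.
  In this encoding the leaf \<open>P\<close> itself is represented by the set \<open>L\<close> of all labels, its
  neighbour by \<open>L - {P}\<close> and the leaf \<open>a \<noteq> P\<close> by \<open>{a}\<close>.\<close>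

definition hierarchy :: "'a set \<Rightarrow> 'a \<Rightarrow> 'a set set \<Rightarrow> 'a set set" where
  "hierarchy L P F = F \<union> {L - {P}, L} \<union> (\<lambda>a. {a}) ` (L - {P})"

definition covers :: "'a set set \<Rightarrow> 'a set \<Rightarrow> 'a set \<Rightarrow> bool" where
  "covers H X Y \<longleftrightarrow> X \<in> H \<and> Y \<in> H \<and> X \<subset> Y \<and> (\<forall>Z\<in>H. X \<subset> Z \<longrightarrow> \<not> Z \<subset> Y)"

definition hasse_tree :: "'a set \<Rightarrow> 'a \<Rightarrow> 'a set set \<Rightarrow> ('a set, 'a) labelled_graph" where
  "hasse_tree L P F =
     \<lparr>verts = hierarchy L P F,
      edges = {{X, Y} |X Y. covers (hierarchy L P F) X Y},
      leaf_of = (\<lambda>a. if a = P then L else {a})\<rparr>"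

text \<open>The set \<open>verts \<Gamma> - {P}\<close> is barred because it belongs to the
  neighbour of the leaf \<open>P\<close>, whose upward edge ends in that leaf and so is not
  internal.\<close>

definition cluster_families :: "'a sgraph \<Rightarrow> 'a \<Rightarrow> 'a set set set" where
  "cluster_families \<Gamma> P = laminar_subfamilies (edge_sets \<Gamma> (verts \<Gamma> - {P}) - {verts \<Gamma> - {P}})"

section \<open>Clusters of a stable tree rooted at its leaf \<open>P\<close>\<close>

locale rooted_stable_tree = parent_tree T "leaf_of T P" p d
  for T :: "('v, 'a) labelled_graph" and P :: 'a and p d +
  fixes \<Gamma> :: "'a sgraph"
  assumes stable: "stable_tree \<Gamma> T"
    and simple: "finite_simple_graph \<Gamma>"
    and P: "P \<in> verts \<Gamma>"
    and card3: "3 \<le> card (verts \<Gamma>)"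
begin

abbreviation r where "r \<equiv> leaf_of T P"

definition children :: "'v \<Rightarrow> 'v set" where
  "children v = {w \<in> verts T - {r}. p w = v}"

definition cluster :: "'v \<Rightarrow> 'a set" where
  "cluster v = {a \<in> verts \<Gamma>. (leaf_of T a, v) \<in> par\<^sup>*}"

lemma leaves_eq: "leaves T = leaf_of T ` verts \<Gamma>"
  and inj_leaf: "inj_on (leaf_of T) (verts \<Gamma>)"
  using stable unfolding stable_tree_def bij_betw_def by auto

lemma leaf_verts: "a \<in> verts \<Gamma> \<Longrightarrow> leaf_of T a \<in> verts T"
  using leaves_eq unfolding leaves_def by blast

lemma degree_children:
  "v \<in> verts T \<Longrightarrow> degree T v = card (children v) + (if v = r then 0 else 1)"
  unfolding children_def by (rule degree_eq)

lemma finite_children: "finite (children v)"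
  unfolding children_def using finite_verts by simp

lemma children_iff: "w \<in> children v \<longleftrightarrow> (w, v) \<in> par"
  unfolding children_def par_iff by auto

lemma leaf_eq_root_iff: "a \<in> verts \<Gamma> \<Longrightarrow> leaf_of T a = r \<longleftrightarrow> a = P"
  using inj_leaf P by (auto dest: inj_onD)

lemma children_leaf:
  assumes "a \<in> verts \<Gamma>" "a \<noteq> P"
  shows "children (leaf_of T a) = {}"
proof -
  have "degree T (leaf_of T a) = 1" using leaves_eq assms(1) unfolding leaves_def by blast
  then have "card (children (leaf_of T a)) = 0"
    using degree_children[OF leaf_verts[OF assms(1)]] leaf_eq_root_iff[OF assms(1)] assms(2)
    by simp
  then show ?thesis using finite_children by simp
qed

definition top :: 'v where "top = (THE v. children r = {v})"

lemma children_root: "children r = {top}"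
proof -
  have "degree T r = 1" using leaves_eq P unfolding leaves_def by blast
  then have "card (children r) = 1" using degree_children[OF root] by simp
  then obtain v where "children r = {v}" by (rule card_1_singletonE)
  then show ?thesis unfolding top_def by simp
qed

lemma children_internal:
  assumes "v \<in> internal_verts T"
  shows "2 \<le> card (children v)"
proof -
  have "v \<in> verts T" "v \<noteq> r" "3 \<le> degree T v"
    using assms stable leaves_eq P unfolding internal_verts_def stable_tree_def by auto
  then show ?thesis using degree_children[of v] by simp
qed

lemma childless_is_leaf:
  assumes "v \<in> verts T" "v \<noteq> r" "children v = {}"
  obtains a where "a \<in> verts \<Gamma>" "a \<noteq> P" "v = leaf_of T a"
proof -
  have "v \<in> leaves T" using degree_children[of v] assms unfolding leaves_def by simp
  then obtain a where "a \<in> verts \<Gamma>" "v = leaf_of T a" unfolding leaves_eq by blast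
  then show thesis using assms(2) by (intro that[of a]) auto
qed

lemma parent_not_leaf:
  assumes "v \<in> verts T" "v \<noteq> r" "p v \<noteq> r"
  shows "p v \<in> internal_verts T"
proof -
  have "v \<in> children (p v)" using assms unfolding children_def by simp
  have "p v \<notin> leaves T"
  proof
    assume "p v \<in> leaves T"
    then obtain a where a: "a \<in> verts \<Gamma>" "p v = leaf_of T a" unfolding leaves_eq by blast
    then have "a \<noteq> P" using assms(3) by auto
    then show False using children_leaf[OF a(1)] \<open>v \<in> children (p v)\<close> a(2) by simp
  qed
  then show ?thesis using parent_verts[OF assms(1,2)] unfolding internal_verts_def by simp
qed

lemma cluster_mono: "(u, v) \<in> par\<^sup>* \<Longrightarrow> cluster u \<subseteq> cluster v"
  unfolding cluster_def by (auto intro: rtrancl_trans)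

lemma cluster_meet:
  "cluster u \<inter> cluster v \<noteq> {} \<Longrightarrow> (u, v) \<in> par\<^sup>* \<or> (v, u) \<in> par\<^sup>*"
  unfolding cluster_def using par_linear by blast

text \<open>A vertex of maximal rank below \<open>v\<close> has no children; it is not the root,
  which has the child \<open>top\<close>, so it is a labelled leaf.\<close>

lemma cluster_nonempty:
  assumes v: "v \<in> verts T"
  shows "cluster v \<noteq> {}"
proof -
  let ?D = "{u \<in> verts T. (u, v) \<in> par\<^sup>*}"
  have fin: "finite ?D" and ne: "?D \<noteq> {}" using finite_verts v by auto
  have "Max (d ` ?D) \<in> d ` ?D" by (rule Max_in) (use fin ne in auto)
  then obtain u where u: "u \<in> ?D" "d u = Max (d ` ?D)" by auto
  have max: "d w \<le> d u" if "w \<in> ?D" for w using u(2) fin that by simp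
  have "children u = {}"
  proof (rule ccontr)
    assume "children u \<noteq> {}"
    then obtain w where "w \<in> verts T" "w \<noteq> r" "p w = u" unfolding children_def by blast
    then have w: "(w, u) \<in> par" "w \<in> verts T" "d u < d w"
      using parent_depth[of w] by (auto simp: par_iff)
    then have "w \<in> ?D" using u(1) by (auto intro: converse_rtrancl_into_rtrancl)
    then show False using max[of w] w(3) by simp
  qed
  moreover from this have "u \<noteq> r" using children_root by auto
  ultimately obtain a where "a \<in> verts \<Gamma>" "u = leaf_of T a"
    using childless_is_leaf[of u] u(1) by blast
  then have "a \<in> cluster v" using u(1) unfolding cluster_def by blast
  then show ?thesis by blast
qed

lemma cluster_root: "cluster r = verts \<Gamma>"
  unfolding cluster_def using reaches_root leaf_verts by blast

lemma P_mem_cluster_iff: "P \<in> cluster v \<longleftrightarrow> v = r"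
  unfolding cluster_def using P par_root_rtrancl by auto

text \<open>Strictness comes from stability: an internal parent has a second child, whose nonempty
  cluster is disjoint from that of \<open>v\<close>. If the parent is the root, the additional label
  is \<open>P\<close>.\<close>

lemma cluster_parent:
  assumes v: "v \<in> verts T" "v \<noteq> r"
  shows "cluster v \<subset> cluster (p v)"
proof -
  have sub: "cluster v \<subseteq> cluster (p v)" by (rule cluster_mono) (use v in \<open>auto simp: par_iff\<close>)
  show ?thesis
  proof (cases "p v = r")
    case True
    then show ?thesis using sub v(2) P_mem_cluster_iff[of v] P_mem_cluster_iff[of "p v"] by auto
  next
    case False
    have "2 \<le> card (children (p v))" by (rule children_internal[OF parent_not_leaf[OF v False]])
    moreover have "card (children (p v)) \<le> 1" if "children (p v) \<subseteq> {v}"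
      using card_mono[OF _ that] by simp
    ultimately obtain w where "w \<in> children (p v)" "w \<noteq> v" by fastforce
    then have w: "w \<in> verts T" "w \<noteq> r" "p w = p v" "w \<noteq> v" unfolding children_def by auto
    \<comment> \<open>Siblings are incomparable: climbing from one to the other would pass through
      their parent, which already has smaller rank.\<close>
    have no: "(x, y) \<notin> par\<^sup>*" if "y \<in> verts T" "y \<noteq> r" "x \<noteq> y" "p x = p y" for x y
    proof
      assume "(x, y) \<in> par\<^sup>*"
      then have "(p y, y) \<in> par\<^sup>*" using par_rtrancl_step(3) that by metis
      then show False
        using par_rtrancl_depth parent_depth[OF that(1,2)] by fastforce
    qed
    have "cluster w \<inter> cluster v = {}"
      using cluster_meet[of w v] no[of v w] no[of w v] v w by auto
    moreover have "cluster w \<subseteq> cluster (p v)"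
      by (rule cluster_mono) (use w in \<open>auto simp: par_iff\<close>)
    ultimately show ?thesis using sub cluster_nonempty[OF w(1)] by blast
  qed
qed

text \<open>Nested clusters share a label, so the vertices are comparable; the wrong order would
  give a strict inclusion the other way by \<open>cluster_parent\<close>.\<close>

lemma cluster_subset_iff:
  assumes "u \<in> verts T" "v \<in> verts T"
  shows "cluster u \<subseteq> cluster v \<longleftrightarrow> (u, v) \<in> par\<^sup>*"
proof
  assume sub: "cluster u \<subseteq> cluster v"
  then have "cluster u \<inter> cluster v \<noteq> {}" using cluster_nonempty[OF assms(1)] by blast
  then consider "(u, v) \<in> par\<^sup>*" | "(v, u) \<in> par\<^sup>*" "v \<noteq> u"
    using cluster_meet by auto
  then show "(u, v) \<in> par\<^sup>*"
  proof cases
    case 2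
    then have "v \<noteq> r" "(p v, u) \<in> par\<^sup>*" using par_rtrancl_step by blast+
    then have "cluster v \<subset> cluster u" using cluster_parent assms(2) cluster_mono by blast
    with sub show ?thesis by blast
  qed
qed (rule cluster_mono)

lemma cluster_eq_iff: "u \<in> verts T \<Longrightarrow> v \<in> verts T \<Longrightarrow> cluster u = cluster v \<longleftrightarrow> u = v"
  using cluster_subset_iff[of u v] cluster_subset_iff[of v u] par_antisym[of u v] by auto

lemma cluster_leaf:
  assumes a: "a \<in> verts \<Gamma>" "a \<noteq> P"
  shows "cluster (leaf_of T a) = {a}"
proof -
  have "b = a" if b: "b \<in> verts \<Gamma>" "(leaf_of T b, leaf_of T a) \<in> par\<^sup>*" for b
    using b(2)
  proof (cases rule: rtranclE)
    case base
    then show ?thesis using inj_leaf a b by (auto dest: inj_onD)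
  next
    case (step w)
    then have "w \<in> children (leaf_of T a)" unfolding children_def by (simp add: par_iff)
    then show ?thesis using children_leaf[OF a] by simp
  qed
  then show ?thesis using a unfolding cluster_def by auto
qed

lemma top_props: "top \<in> verts T" "top \<noteq> r" "p top = r"
  using children_root unfolding children_def by blast+

lemma cluster_top: "cluster top = verts \<Gamma> - {P}"
proof -
  have "a \<in> cluster top" if a: "a \<in> verts \<Gamma>" "a \<noteq> P" for a
    using reaches_root[OF leaf_verts[OF a(1)]]
  proof (cases rule: rtranclE)
    case base
    then show ?thesis using leaf_eq_root_iff a by simp
  next
    case (step w)
    then have "w \<in> children r" unfolding children_iff by blast
    then have "w = top" using children_root by simp
    then show ?thesis using step a unfolding cluster_def by simp
  qed
  moreover have "cluster top \<subseteq> verts \<Gamma>" unfolding cluster_def by blast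
  ultimately show ?thesis using P_mem_cluster_iff[of top] top_props(2) by blast
qed

text \<open>If the neighbour of the root were a leaf, there would be only one label besides
  \<open>P\<close>; having three labels excludes this.\<close>

lemma top_internal: "top \<in> internal_verts T"
proof -
  have "top \<noteq> leaf_of T a" if "a \<in> verts \<Gamma>" for a
  proof
    assume "top = leaf_of T a"
    then have "verts \<Gamma> - {P} = {a}"
      using cluster_top cluster_leaf[of a] that top_props(2) by auto
    then have "card (verts \<Gamma> - {P}) = 1" by simp
    then show False using card3 P by simp
  qed
  then show ?thesis using top_props(1) leaves_eq unfolding internal_verts_def by auto
qed

text \<open>An internal vertex other than \<open>top\<close> is the lower end of exactly one
  internal edge, so these are the label sets cut off from \<open>P\<close> by the internal
  edges.\<close>

definition clusters :: "'a set set" where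
  "clusters = cluster ` (internal_verts T - {top})"

lemma image_cluster: "cluster ` verts T = hierarchy (verts \<Gamma>) P clusters"
proof -
  have "verts T = (internal_verts T - {top}) \<union> {top, r} \<union> leaf_of T ` (verts \<Gamma> - {P})"
    using top_internal root leaves_eq leaf_verts unfolding internal_verts_def by auto
  then have "cluster ` verts T = cluster `
      ((internal_verts T - {top}) \<union> {top, r} \<union> leaf_of T ` (verts \<Gamma> - {P}))"
    by (rule arg_cong)
  also have "\<dots> =
      clusters \<union> {cluster top, cluster r} \<union> (\<lambda>a. cluster (leaf_of T a)) ` (verts \<Gamma> - {P})"
    unfolding clusters_def by (simp only: image_Un image_image image_insert image_empty)
  also have "(\<lambda>a. cluster (leaf_of T a)) ` (verts \<Gamma> - {P}) = (\<lambda>a. {a}) ` (verts \<Gamma> - {P})"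
    by (rule image_cong) (auto simp: cluster_leaf)
  finally show ?thesis unfolding hierarchy_def cluster_top cluster_root .
qed

text \<open>Stability is applied to the component of \<open>v\<close> after deleting its upward
  edge; that component lies below \<open>v\<close>.\<close>

lemma cluster_spans_edge:
  assumes v: "v \<in> internal_verts T" "v \<noteq> top"
  shows "spans_edge \<Gamma> (cluster v)"
proof -
  have vT: "v \<in> verts T" "v \<noteq> r" using v P leaves_eq unfolding internal_verts_def by auto
  have pr: "p v \<noteq> r" using children_root vT v(2) unfolding children_def by blast
  let ?e = "{v, p v}"
  let ?C = "component_of (delete_edge T ?e) v"
  have "?e \<in> internal_edges T"
    using v(1) vT parent_not_leaf[OF vT pr] edges_eq unfolding internal_edges_def by blast
  moreover have "?C \<in> conn_components (delete_edge T ?e)"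
    unfolding conn_components_def delete_edge_def using vT by simp
  ultimately obtain a b where ab: "{a, b} \<in> edges \<Gamma>" "leaf_of T a \<in> ?C" "leaf_of T b \<in> ?C"
    using stable unfolding stable_tree_def by blast
  \<comment> \<open>A walk from \<open>v\<close> that avoids the deleted edge never leaves the
    subtree: the only step out of it goes up from \<open>v\<close>.\<close>
  have "(x, v) \<in> par\<^sup>*" if "(v, x) \<in> (adj_rel (delete_edge T ?e))\<^sup>*" for x
    using that
  proof (induction rule: rtrancl_induct)
    case (step x y)
    then have "{x, y} \<in> edges T" "{x, y} \<noteq> ?e" unfolding adj_rel_def delete_edge_def by auto
    then have "(x \<noteq> v \<and> y = p x) \<or> (y, x) \<in> par" unfolding edge_iff par_iff by auto
    then show ?case
      using step.IH par_rtrancl_step(3)[of x v] by (auto intro: converse_rtrancl_into_rtrancl)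
  qed simp
  moreover have "a \<in> verts \<Gamma>" "b \<in> verts \<Gamma>"
    using ab(1) simple unfolding finite_simple_graph_def by auto
  ultimately have "{a, b} \<subseteq> cluster v"
    using ab(2,3) unfolding cluster_def component_of_def by blast
  then show ?thesis using ab(1) unfolding spans_edge_def by blast
qed

lemma clusters_mem: "clusters \<in> cluster_families \<Gamma> P"
proof -
  have "cluster v \<in> edge_sets \<Gamma> (verts \<Gamma> - {P}) - {verts \<Gamma> - {P}}"
    if v: "v \<in> internal_verts T" "v \<noteq> top" for v
  proof -
    have vT: "v \<in> verts T" "v \<noteq> r" using v P leaves_eq unfolding internal_verts_def by auto
    have "cluster v \<subseteq> verts \<Gamma>" unfolding cluster_def by blast
    moreover have "cluster v \<noteq> cluster top" using cluster_eq_iff vT(1) top_props(1) v(2) by simp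
    ultimately show ?thesis
      using cluster_spans_edge[OF v] P_mem_cluster_iff[of v] vT(2)
      unfolding edge_sets_def cluster_top by blast
  qed
  moreover have "laminar clusters"
    unfolding laminar_def clusters_def using cluster_meet cluster_mono by blast
  ultimately show ?thesis
    unfolding cluster_families_def laminar_subfamilies_def clusters_def by blast
qed

text \<open>By \<open>cluster_subset_iff\<close> inclusion of clusters is the ancestor relation, so
  covering pairs are child and parent.\<close>

lemma covers_cluster_iff:
  "covers (cluster ` verts T) X Y \<longleftrightarrow> (\<exists>v\<in>verts T - {r}. X = cluster v \<and> Y = cluster (p v))"
proof
  assume cov: "covers (cluster ` verts T) X Y"
  then obtain v u where vu: "v \<in> verts T" "u \<in> verts T" "X = cluster v" "Y = cluster u" "X \<subset> Y"
    unfolding covers_def by blast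
  then have "(v, u) \<in> par\<^sup>*" "v \<noteq> u" using cluster_subset_iff by auto
  then have v: "v \<noteq> r" "(p v, u) \<in> par\<^sup>*" using par_rtrancl_step by blast+
  then have "cluster v \<subset> cluster (p v)" "cluster (p v) \<subseteq> cluster u" "p v \<in> verts T"
    using cluster_parent cluster_mono parent_verts vu(1) by auto
  moreover from this have "\<not> cluster (p v) \<subset> Y" using cov vu(3) unfolding covers_def by simp
  ultimately have "cluster (p v) = Y" using vu(4) by blast
  then show "\<exists>v\<in>verts T - {r}. X = cluster v \<and> Y = cluster (p v)" using vu v by blast
next
  assume "\<exists>v\<in>verts T - {r}. X = cluster v \<and> Y = cluster (p v)"
  then obtain v where v: "v \<in> verts T" "v \<noteq> r" "X = cluster v" "Y = cluster (p v)" by blast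
  have "\<not> cluster z \<subset> Y" if z: "z \<in> verts T" "X \<subset> cluster z" for z
  proof -
    have "(v, z) \<in> par\<^sup>*" "v \<noteq> z" using z v cluster_subset_iff[of v z] by auto
    then have "(p v, z) \<in> par\<^sup>*" by (rule par_rtrancl_step(3))
    then have "Y \<subseteq> cluster z" unfolding v(4) by (rule cluster_mono)
    then show ?thesis by blast
  qed
  then show "covers (cluster ` verts T) X Y"
    unfolding covers_def using v cluster_parent[OF v(1,2)] parent_verts[OF v(1,2)] by auto
qed

lemma label_iso_hasse_tree: "label_iso (verts \<Gamma>) T (hasse_tree (verts \<Gamma>) P clusters)"
  unfolding label_iso_def
proof (intro exI conjI ballI)
  show "bij_betw cluster (verts T) (verts (hasse_tree (verts \<Gamma>) P clusters))"
    unfolding bij_betw_def inj_on_def hasse_tree_def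
    using cluster_eq_iff by (simp add: image_cluster)
  have "(\<lambda>e. cluster ` e) ` edges T = (\<lambda>v. {cluster v, cluster (p v)}) ` (verts T - {r})"
    unfolding edges_eq by (simp add: image_image)
  also have "\<dots> = {{X, Y} |X Y. covers (cluster ` verts T) X Y}"
    unfolding covers_cluster_iff by blast
  finally show "(\<lambda>e. cluster ` e) ` edges T = edges (hasse_tree (verts \<Gamma>) P clusters)"
    unfolding hasse_tree_def by (simp add: image_cluster)
  show "cluster (leaf_of T a) = leaf_of (hasse_tree (verts \<Gamma>) P clusters) a"
    if "a \<in> verts \<Gamma>" for a
    using that cluster_root cluster_leaf unfolding hasse_tree_def by simp
qed

end

lemma stable_tree_label_iso_hasse_tree:
  assumes st: "stable_tree \<Gamma> T" and \<Gamma>: "finite_simple_graph \<Gamma>" "P \<in> verts \<Gamma>" "3 \<le> card (verts \<Gamma>)"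
  obtains F where "F \<in> cluster_families \<Gamma> P" "label_iso (verts \<Gamma>) T (hasse_tree (verts \<Gamma>) P F)"
proof -
  have "is_tree T" "leaf_of T P \<in> verts T"
    using st \<Gamma>(2) unfolding stable_tree_def bij_betw_def leaves_def by auto
  then obtain p d where "parent_tree T (leaf_of T P) p d" by (rule is_tree_parent_tree)
  then interpret rooted_stable_tree T P p d \<Gamma>
    using st \<Gamma> by (simp add: rooted_stable_tree_def rooted_stable_tree_axioms_def)
  show thesis by (rule that[OF clusters_mem label_iso_hasse_tree])
qed

section \<open>The stable tree of a laminar family\<close>

locale cluster_hierarchy =
  fixes \<Gamma> :: "'a sgraph" and P :: 'a and F :: "'a set set"
  assumes simple: "finite_simple_graph \<Gamma>"
    and dom: "dominating \<Gamma> P"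
    and card3: "3 \<le> card (verts \<Gamma>)"
    and F: "F \<in> cluster_families \<Gamma> P"
begin

abbreviation L where "L \<equiv> verts \<Gamma>"

abbreviation H where "H \<equiv> hierarchy L P F"

text \<open>By laminarity the members strictly above a member \<open>X\<close> form a chain, so for
  \<open>X \<noteq> L\<close> this intersection is itself a member: the unique cover of
  \<open>X\<close>.\<close>

definition up :: "'a set \<Rightarrow> 'a set" where
  "up X = \<Inter>{Y \<in> H. X \<subset> Y}"

definition depth :: "'a set \<Rightarrow> nat" where
  "depth X = card L - card X"

lemma P: "P \<in> L"
  using dom unfolding dominating_def by blast

lemma finite_L: "finite L"
  using simple unfolding finite_simple_graph_def by blast

lemma card_L_minus: "2 \<le> card (L - {P})"
  using card3 P finite_L by simp

lemma F_spans: "X \<in> F \<Longrightarrow> spans_edge \<Gamma> X"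
  and F_psubset: "X \<in> F \<Longrightarrow> X \<subset> L - {P}"
  using F unfolding cluster_families_def laminar_subfamilies_def edge_sets_def by auto

lemma card_F:
  assumes "X \<in> F"
  shows "2 \<le> card X"
proof -
  obtain e where "e \<in> edges \<Gamma>" "e \<subseteq> X" using F_spans[OF assms] unfolding spans_edge_def by blast
  moreover have "finite X" using F_psubset[OF assms] finite_L finite_subset by blast
  ultimately show ?thesis
    using simple card_mono[of X e] unfolding finite_simple_graph_def by auto
qed

lemma H_cases:
  assumes "X \<in> H"
  obtains "X = L" | a where "a \<in> L" "a \<noteq> P" "X = {a}" | "X \<in> insert (L - {P}) F"
  using assms unfolding hierarchy_def by blast

lemma L_mem: "L \<in> H" and top_mem: "L - {P} \<in> H"
  and singleton_mem: "a \<in> L \<Longrightarrow> a \<noteq> P \<Longrightarrow> {a} \<in> H"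
  and F_mem: "X \<in> F \<Longrightarrow> X \<in> H"
  unfolding hierarchy_def by auto

lemma card_inner: "X \<in> insert (L - {P}) F \<Longrightarrow> 2 \<le> card X"
  using card_F[of X] card_L_minus by (elim insertE) simp_all

lemma H_not_L:
  assumes "X \<in> H" "X \<noteq> L"
  shows "X \<subseteq> L - {P}"
  using assms(1)
proof (cases rule: H_cases)
  case 3
  then show ?thesis using F_psubset[of X] by blast
qed (use assms(2) in auto)

lemma H_subset: "X \<in> H \<Longrightarrow> X \<subseteq> L"
  using H_not_L by blast

lemma H_nonempty:
  assumes "X \<in> H"
  shows "X \<noteq> {}"
  using assms
proof (cases rule: H_cases)
  case 3
  then show ?thesis using card_inner[of X] by auto
qed (use P in auto)

lemma finite_H: "finite H"
proof (rule finite_subset)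
  show "H \<subseteq> Pow L" using H_subset by blast
qed (use finite_L in simp)

lemma inner_not_singleton:
  assumes "X \<in> insert (L - {P}) F"
  shows "X \<noteq> {a}"
proof
  assume "X = {a}"
  then have "card X = 1" by simp
  then show False using card_inner[OF assms] by simp
qed

lemma laminar_H: "laminar H"
proof -
  have "laminar F" using F unfolding cluster_families_def laminar_subfamilies_def by blast
  then have "laminar (insert (L - {P}) F)" by (rule laminar_insert) (use F_psubset in blast)
  then have 1: "laminar (insert L (insert (L - {P}) F))"
    by (rule laminar_insert) (use F_psubset in blast)
  have "X \<subseteq> Y \<or> Y \<subseteq> X \<or> X \<inter> Y = {}" if X: "X \<in> H" and Y: "Y \<in> H" for X Y
  proof (cases "(\<exists>a. X = {a}) \<or> (\<exists>a. Y = {a})")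
    case True
    then show ?thesis by auto
  next
    case False
    then have "X \<in> insert L (insert (L - {P}) F)" "Y \<in> insert L (insert (L - {P}) F)"
      using X Y unfolding hierarchy_def by auto
    then show ?thesis by (rule 1[unfolded laminar_def, rule_format])
  qed
  then show ?thesis unfolding laminar_def by simp
qed

lemma up_mem:
  assumes X: "X \<in> H" "X \<noteq> L"
  shows "up X \<in> H" "X \<subset> up X"
proof -
  let ?U = "{Y \<in> H. X \<subset> Y}"
  have "L \<in> ?U" using L_mem H_subset[OF X(1)] X(2) by auto
  moreover have "subset.chain UNIV ?U"
    using laminar_H H_nonempty[OF X(1)] unfolding subset.chain_def laminar_def by blast
  ultimately have "\<Inter>?U \<in> ?U" using finite_H by (intro Inter_in_chain[of _ UNIV]) auto
  then show "up X \<in> H" "X \<subset> up X" unfolding up_def by auto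
qed

lemma up_least: "Y \<in> H \<Longrightarrow> X \<subset> Y \<Longrightarrow> up X \<subseteq> Y"
  unfolding up_def by blast

lemma up_not_singleton:
  assumes "X \<in> H" "X \<noteq> L"
  shows "up X \<noteq> {a}"
proof
  assume "up X = {a}"
  then have "X \<subset> {a}" using up_mem(2)[OF assms] by simp
  then show False using H_nonempty[OF assms(1)] by (simp add: psubset_eq subset_singleton_iff)
qed

lemma covers_iff: "covers H X Y \<longleftrightarrow> X \<in> H \<and> X \<noteq> L \<and> Y = up X"
proof
  assume cov: "covers H X Y"
  then have XY: "X \<in> H" "Y \<in> H" "X \<subset> Y" unfolding covers_def by auto
  then have "X \<noteq> L" using H_subset by blast
  moreover from this have "\<not> up X \<subset> Y" using cov up_mem[of X] XY(1) unfolding covers_def by simp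
  ultimately show "X \<in> H \<and> X \<noteq> L \<and> Y = up X" using XY up_least by blast
next
  assume "X \<in> H \<and> X \<noteq> L \<and> Y = up X"
  then show "covers H X Y" using up_mem[of X] up_least[of _ X] unfolding covers_def by blast
qed

sublocale parent_tree "hasse_tree L P F" L up depth
proof unfold_locales
  show "finite (verts (hasse_tree L P F))" "L \<in> verts (hasse_tree L P F)"
    using finite_H L_mem unfolding hasse_tree_def by simp_all
  show "edges (hasse_tree L P F) = (\<lambda>X. {X, up X}) ` (verts (hasse_tree L P F) - {L})"
    unfolding hasse_tree_def covers_iff by auto
  fix X assume X: "X \<in> verts (hasse_tree L P F)" "X \<noteq> L"
  then have "X \<in> H" unfolding hasse_tree_def by simp
  note up = up_mem[OF this X(2)]
  then show "up X \<in> verts (hasse_tree L P F)" unfolding hasse_tree_def by simp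
  have "card X < card (up X)"
    by (rule psubset_card_mono) (use up(2) finite_subset[OF H_subset[OF up(1)] finite_L] in auto)
  moreover have "card (up X) \<le> card L" using up(1) H_subset finite_L by (auto intro: card_mono)
  ultimately show "depth (up X) < depth X" unfolding depth_def by linarith
qed

lemma verts_hasse: "verts (hasse_tree L P F) = H"
  unfolding hasse_tree_def by simp

lemma leaf_of_hasse: "leaf_of (hasse_tree L P F) a = (if a = P then L else {a})"
  unfolding hasse_tree_def by simp

lemma up_top: "up (L - {P}) = L"
proof -
  have "L - {P} \<noteq> L" using P by blast
  note up = up_mem[OF top_mem this]
  then show ?thesis using H_subset[OF up(1)] by blast
qed

text \<open>The child is the largest member strictly below \<open>X\<close> that contains
  \<open>a\<close>; the candidates form a chain, nonempty because of \<open>{a}\<close>.\<close>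

lemma child_containing:
  assumes X: "X \<in> H" "a \<in> X" "a \<noteq> P" "X \<noteq> {a}"
  obtains Z where "Z \<in> H" "Z \<noteq> L" "a \<in> Z" "Z \<subset> X" "up Z = X"
proof -
  let ?C = "{Z \<in> H. a \<in> Z \<and> Z \<subset> X}"
  have "{a} \<in> ?C" using X singleton_mem[of a] H_subset[OF X(1)] by auto
  moreover have "laminar ?C" by (rule laminar_subset[OF laminar_H]) auto
  ultimately have "\<Union>?C \<in> ?C" using finite_H by (intro Union_mem_laminar[of _ a]) auto
  then obtain Z where Z: "Z = \<Union>?C" "Z \<in> H" "a \<in> Z" "Z \<subset> X" by blast
  have ZL: "Z \<noteq> L" using Z(4) H_subset[OF X(1)] by blast
  have "up Z \<subseteq> X" using up_least[OF X(1) Z(4)] .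
  moreover have "\<not> up Z \<subset> X"
  proof
    assume "up Z \<subset> X"
    then have "up Z \<in> ?C" using up_mem[OF Z(2) ZL] Z(3) by blast
    then have "up Z \<subseteq> Z" using Z(1) by blast
    then show False using up_mem[OF Z(2) ZL] by blast
  qed
  ultimately show thesis using that Z ZL by blast
qed

lemma degree_singleton:
  assumes "a \<in> L" "a \<noteq> P"
  shows "degree (hasse_tree L P F) {a} = 1"
proof -
  have no: "{Z \<in> H - {L}. up Z = {a}} = {}" using up_not_singleton by auto
  have "{a} \<noteq> L" using assms P by auto
  then have "degree (hasse_tree L P F) {a} = card {Z \<in> H - {L}. up Z = {a}} + 1"
    using degree_eq[of "{a}"] singleton_mem[OF assms] unfolding verts_hasse by simp
  then show ?thesis unfolding no by simp
qed

lemma degree_L: "degree (hasse_tree L P F) L = 1"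
proof -
  have "{Z \<in> H - {L}. up Z = L} = {L - {P}}"
  proof (intro set_eqI iffI)
    fix Z assume "Z \<in> {Z \<in> H - {L}. up Z = L}"
    then have Z: "Z \<in> H" "Z \<noteq> L" "up Z = L" by auto
    then have "\<not> Z \<subset> L - {P}" using up_least[OF top_mem, of Z] P by blast
    then show "Z \<in> {L - {P}}" using H_not_L[OF Z(1,2)] by blast
  next
    fix Z assume "Z \<in> {L - {P}}"
    then show "Z \<in> {Z \<in> H - {L}. up Z = L}" using top_mem up_top P by blast
  qed
  then show ?thesis using degree_eq[of L] L_mem unfolding verts_hasse by simp
qed

text \<open>One child contains some \<open>a\<close>, and another contains a point \<open>b\<close>
  that the first misses; the edge to \<open>up X\<close> is the third.\<close>

lemma degree_inner:
  assumes X: "X \<in> insert (L - {P}) F"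
  shows "3 \<le> degree (hasse_tree L P F) X"
proof -
  have XH: "X \<in> H" and PX: "P \<notin> X" using X top_mem F_mem F_psubset by auto
  obtain a where a: "a \<in> X" using H_nonempty[OF XH] by blast
  obtain Y where Y: "Y \<in> H" "Y \<noteq> L" "a \<in> Y" "Y \<subset> X" "up Y = X"
    using child_containing[OF XH a] a PX inner_not_singleton[OF X] by metis
  then obtain b where b: "b \<in> X" "b \<notin> Y" by blast
  obtain Z where Z: "Z \<in> H" "Z \<noteq> L" "b \<in> Z" "up Z = X"
    using child_containing[OF XH b(1)] b PX inner_not_singleton[OF X] by metis
  have "{Y, Z} \<subseteq> {Z \<in> H - {L}. up Z = X}" using Y Z by blast
  then have le: "card {Y, Z} \<le> card {Z \<in> H - {L}. up Z = X}"
    by (rule card_mono[rotated]) (use finite_H in simp)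
  have "Y \<noteq> Z" using b(2) Z(3) by blast
  then have "card {Y, Z} = 2" by simp
  moreover have "X \<noteq> L" using PX P by blast
  ultimately show ?thesis using le degree_eq[of X] XH unfolding verts_hasse by simp
qed

lemma leaves_hasse: "leaves (hasse_tree L P F) = insert L ((\<lambda>a. {a}) ` (L - {P}))"
proof (intro set_eqI iffI)
  fix X assume "X \<in> leaves (hasse_tree L P F)"
  then have X: "X \<in> H" "degree (hasse_tree L P F) X = 1" unfolding leaves_def verts_hasse by auto
  from X(1) show "X \<in> insert L ((\<lambda>a. {a}) ` (L - {P}))"
    by (rule H_cases) (use degree_inner[of X] X(2) in auto)
next
  fix X assume "X \<in> insert L ((\<lambda>a. {a}) ` (L - {P}))"
  then show "X \<in> leaves (hasse_tree L P F)"
    using degree_L degree_singleton L_mem singleton_mem unfolding leaves_def verts_hasse by auto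
qed

lemma internal_verts_hasse: "internal_verts (hasse_tree L P F) = insert (L - {P}) F"
proof -
  have "X \<notin> leaves (hasse_tree L P F)" if "X \<in> insert (L - {P}) F" for X
    using degree_inner[OF that] unfolding leaves_def by auto
  moreover have "H = insert (L - {P}) F \<union> leaves (hasse_tree L P F)"
    unfolding leaves_hasse hierarchy_def by auto
  ultimately show ?thesis unfolding internal_verts_def verts_hasse by blast
qed

lemma L_not_inner: "L \<notin> insert (L - {P}) F"
proof -
  have "L \<noteq> L - {P}" using P by blast
  moreover have "L \<notin> F" using F_psubset[of L] by blast
  ultimately show ?thesis by blast
qed

lemma up_inner:
  assumes X: "X \<in> F"
  shows "up X \<in> insert (L - {P}) F"
proof -
  have XH: "X \<in> H" "X \<noteq> L" "X \<subset> L - {P}" using F_mem X L_not_inner F_psubset by auto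
  note up = up_mem[OF XH(1,2)]
  have "up X \<subseteq> L - {P}" using up_least[OF top_mem XH(3)] .
  then have "up X \<noteq> L" using P by blast
  from up(1) show ?thesis
    by (rule H_cases) (use \<open>up X \<noteq> L\<close> up_not_singleton[OF XH(1,2)] in blast)+
qed

lemma internal_edges_hasse: "internal_edges (hasse_tree L P F) = (\<lambda>X. {X, up X}) ` F"
proof (intro set_eqI iffI)
  fix e assume "e \<in> internal_edges (hasse_tree L P F)"
  then obtain X where X: "e = {X, up X}" "{X, up X} \<subseteq> insert (L - {P}) F"
    unfolding internal_edges_def internal_verts_hasse edges_eq by blast
  then have "X \<noteq> L - {P}" using up_top L_not_inner by auto
  then have "X \<in> F" using X(2) by simp
  then show "e \<in> (\<lambda>X. {X, up X}) ` F" using X(1) by blast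
next
  fix e assume "e \<in> (\<lambda>X. {X, up X}) ` F"
  then obtain X where X: "X \<in> F" "e = {X, up X}" by blast
  then have "X \<in> H - {L}" using F_mem L_not_inner by auto
  then have "e \<in> edges (hasse_tree L P F)" using X(2) unfolding edges_eq verts_hasse by blast
  then show "e \<in> internal_edges (hasse_tree L P F)"
    using X up_inner unfolding internal_edges_def internal_verts_hasse by simp
qed

lemma card_internal_edges_hasse: "card (internal_edges (hasse_tree L P F)) = card F"
proof -
  have "inj_on (\<lambda>X. {X, up X}) F"
    by (rule inj_on_subset[OF inj_parent_edge]) (use F_mem L_not_inner verts_hasse in auto)
  then show ?thesis unfolding internal_edges_hasse by (rule card_image)
qed

lemma subset_par: "X \<in> H \<Longrightarrow> Y \<in> H \<Longrightarrow> X \<subseteq> Y \<Longrightarrow> (X, Y) \<in> par\<^sup>*"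
proof (induction "depth X" arbitrary: X rule: less_induct)
  case less
  show ?case
  proof (cases "X = Y")
    case False
    then have X: "X \<subset> Y" "X \<noteq> L" using less.prems H_subset by auto
    have "(up X, Y) \<in> par\<^sup>*"
      using less.prems X up_mem up_least parent_depth[of X] verts_hasse
      by (intro less.hyps) auto
    moreover have "(X, up X) \<in> par" using less.prems X verts_hasse by (simp add: par_iff)
    ultimately show ?thesis by (rule converse_rtrancl_into_rtrancl[rotated])
  qed simp
qed

lemma stable_hasse_tree: "stable_tree \<Gamma> (hasse_tree L P F)"
  unfolding stable_tree_def
proof (intro conjI ballI)
  show "is_tree (hasse_tree L P F)" by (rule is_tree)
  have "inj_on (\<lambda>a. if a = P then L else {a}) L"
  proof (rule inj_onI)
    fix a b assume "a \<in> L" "b \<in> L" "(if a = P then L else {a}) = (if b = P then L else {b})"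
    then show "a = b" using P by (auto split: if_splits)
  qed
  moreover have "(\<lambda>a. if a = P then L else {a}) ` L = leaves (hasse_tree L P F)"
    unfolding leaves_hasse using P by auto
  ultimately show "bij_betw (leaf_of (hasse_tree L P F)) L (leaves (hasse_tree L P F))"
    unfolding bij_betw_def by (simp add: hasse_tree_def)
  show "3 \<le> degree (hasse_tree L P F) X" if "X \<in> internal_verts (hasse_tree L P F)" for X
    using that degree_inner unfolding internal_verts_hasse by blast
  fix e C
  assume "e \<in> internal_edges (hasse_tree L P F)"
  then obtain X where X: "X \<in> F" "e = {X, up X}" unfolding internal_edges_hasse by blast
  let ?R = "adj_rel (delete_edge (hasse_tree L P F) e)"
  assume "C \<in> conn_components (delete_edge (hasse_tree L P F) e)"
  then obtain Y where Y: "Y \<in> H" "C = {Z \<in> H. (Y, Z) \<in> ?R\<^sup>*}"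
    unfolding conn_components_def component_of_def delete_edge_def by (auto simp: verts_hasse)
  have XH: "X \<in> H" "X \<noteq> L" using F_mem X(1) L_not_inner by auto
  have step: "(Z, up Z) \<in> ?R" if "Z \<in> H" "Z \<noteq> L" "Z \<noteq> X" for Z
  proof -
    have "{Z, up Z} \<noteq> e"
      using inj_onD[OF inj_parent_edge, of Z X] that X(2) XH unfolding verts_hasse by auto
    then show ?thesis
      using that unfolding adj_rel_def delete_edge_def by (simp add: edges_eq verts_hasse)
  qed
  \<comment> \<open>Cutting the edge above \<open>X\<close> leaves two groups: the members inside
    \<open>X\<close> all climb to \<open>X\<close>, and the others all climb to
    \<open>L\<close>.\<close>
  have below: "(Z, X) \<in> ?R\<^sup>*" if "Z \<in> H" "Z \<subseteq> X" for Z
    using that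
  proof (induction "depth Z" arbitrary: Z rule: less_induct)
    case less
    show ?case
    proof (cases "Z = X")
      case False
      then have Z: "Z \<subset> X" "Z \<noteq> L" using less.prems H_subset[OF XH(1)] by auto
      have "(up Z, X) \<in> ?R\<^sup>*"
        using less.prems Z up_mem up_least[OF XH(1)] parent_depth[of Z] verts_hasse
        by (intro less.hyps) auto
      then show ?thesis
        using step[of Z] less.prems Z False by (auto intro: converse_rtrancl_into_rtrancl)
    qed simp
  qed
  have above: "(Z, L) \<in> ?R\<^sup>*" if "Z \<in> H" "\<not> Z \<subseteq> X" for Z
    using that
  proof (induction "depth Z" arbitrary: Z rule: less_induct)
    case less
    show ?case
    proof (cases "Z = L")
      case False
      have "up Z \<in> H" "Z \<subset> up Z" using up_mem less.prems False by auto
      then have "(up Z, L) \<in> ?R\<^sup>*"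
        using less.prems False parent_depth[of Z] verts_hasse by (intro less.hyps) auto
      then show ?thesis
        using step[of Z] less.prems False by (auto intro: converse_rtrancl_into_rtrancl)
    qed simp
  qed
  have "sym ?R" unfolding sym_def adj_rel_def by (simp add: insert_commute)
  then have sym: "(v, u) \<in> ?R\<^sup>*" if "(u, v) \<in> ?R\<^sup>*" for u v
    using that sym_rtrancl symD by metis
  show "\<exists>a b. {a, b} \<in> edges \<Gamma> \<and> leaf_of (hasse_tree L P F) a \<in> C \<and> leaf_of (hasse_tree L P F) b \<in> C"
  proof (cases "Y \<subseteq> X")
    case True
    obtain e' where e': "e' \<in> edges \<Gamma>" "e' \<subseteq> X" using F_spans[OF X(1)] unfolding spans_edge_def by blast
    then obtain a b where ab: "e' = {a, b}"
      using simple unfolding finite_simple_graph_def by (metis card_2_iff)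
    have mem: "{c} \<in> C" "c \<noteq> P" if "c \<in> X" for c
    proof -
      have c: "c \<in> L" "c \<noteq> P" using that F_psubset[OF X(1)] by auto
      then have "({c}, X) \<in> ?R\<^sup>*" using below singleton_mem that by simp
      then have "(Y, {c}) \<in> ?R\<^sup>*" using below[OF Y(1) True] sym by (blast intro: rtrancl_trans)
      then show "{c} \<in> C" "c \<noteq> P" using Y(2) singleton_mem c by auto
    qed
    then show ?thesis using e' ab by (intro exI[of _ a] exI[of _ b]) (simp add: leaf_of_hasse)
  next
    case False
    \<comment> \<open>On the side of \<open>P\<close> the required edge joins \<open>P\<close> to a
      label outside \<open>X\<close>, which exists because \<open>X\<close> is a proper subset of
      \<open>L - {P}\<close>; here \<open>P\<close> being dominating is used.\<close>
    obtain b where b: "b \<in> L" "b \<noteq> P" "b \<notin> X" using F_psubset[OF X(1)] by blast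
    then have "({b}, L) \<in> ?R\<^sup>*" using above singleton_mem by simp
    moreover have "(Y, L) \<in> ?R\<^sup>*" using above[OF Y(1) False] .
    ultimately have "{b} \<in> C" "L \<in> C"
      using sym Y(2) singleton_mem b L_mem by (auto intro: rtrancl_trans)
    moreover have "{P, b} \<in> edges \<Gamma>" using dom b unfolding dominating_def by blast
    ultimately show ?thesis using b by (intro exI[of _ P] exI[of _ b]) (simp add: leaf_of_hasse)
  qed
qed

end

section \<open>Isomorphism classes\<close>

text \<open>Edges go to edges, so only the direction could be reversed, with \<open>f v\<close> the
  parent of \<open>f (p v)\<close>. By induction that parent is also \<open>f (p (p v))\<close>;
  injectivity then gives \<open>p (p v) = v\<close>, against the strict drop of rank.\<close>

lemma iso_parent:
  assumes S: "parent_tree S r p d" and T: "parent_tree T r' p' d'"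
    and f: "inj_on f (verts S)" "(\<lambda>e. f ` e) ` edges S = edges T" "f r = r'"
    and v: "v \<in> verts S" "v \<noteq> r"
  shows "f (p v) = p' (f v)"
  using v
proof (induction "d v" arbitrary: v rule: less_induct)
  case less
  interpret S: parent_tree S r p d by fact
  interpret T: parent_tree T r' p' d' by fact
  have "{v, p v} \<in> edges S" using less.prems S.edges_eq by blast
  then have "f ` {v, p v} \<in> edges T" unfolding f(2)[symmetric] by (rule imageI)
  then have "{f v, f (p v)} \<in> edges T" by simp
  then consider "f (p v) = p' (f v)" | "f (p v) \<noteq> r'" "f v = p' (f (p v))"
    unfolding T.edge_iff T.par_iff by blast
  then show ?case
  proof cases
    case 2
    have pv: "p v \<in> verts S" "d (p v) < d v"
      using S.parent_verts S.parent_depth less.prems by auto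
    have pr: "p v \<noteq> r" using 2(1) f(3) by auto
    then have "f (p (p v)) = f v" using less.hyps[OF pv(2,1)] 2(2) by simp
    then have "p (p v) = v" using f(1) S.parent_verts[OF pv(1) pr] less.prems(1) by (auto dest: inj_onD)
    then show ?thesis using S.parent_depth[OF pv(1) pr] pv(2) by simp
  qed
qed

text \<open>Parents go to parents, so \<open>f\<close> is monotone along the climb from the fixed
  leaf \<open>{a}\<close> to any \<open>X\<close> containing \<open>a\<close>. The label
  \<open>P\<close> is set apart because its leaf is \<open>L\<close> and not a singleton.\<close>

lemma hasse_tree_iso_subset:
  assumes F: "cluster_hierarchy \<Gamma> P F" and F': "cluster_hierarchy \<Gamma> P F'"
    and f: "bij_betw f (hierarchy (verts \<Gamma>) P F) (hierarchy (verts \<Gamma>) P F')"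
      "(\<lambda>e. f ` e) ` edges (hasse_tree (verts \<Gamma>) P F) = edges (hasse_tree (verts \<Gamma>) P F')"
      "f (verts \<Gamma>) = verts \<Gamma>" "\<And>a. a \<in> verts \<Gamma> \<Longrightarrow> a \<noteq> P \<Longrightarrow> f {a} = {a}"
    and X: "X \<in> hierarchy (verts \<Gamma>) P F"
  shows "X - {P} \<subseteq> f X"
proof
  interpret A: cluster_hierarchy \<Gamma> P F by fact
  interpret B: cluster_hierarchy \<Gamma> P F' by fact
  have inj: "inj_on f A.H" and im: "f ` A.H = B.H" using f(1) unfolding bij_betw_def by auto
  have up: "f (A.up Y) = B.up (f Y)" if "Y \<in> A.H" "Y \<noteq> A.L" for Y
    by (rule iso_parent[OF A.parent_tree_axioms B.parent_tree_axioms])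
      (use inj f that in \<open>auto simp: A.verts_hasse\<close>)
  have mono: "f Y \<subseteq> f Z" if "(Y, Z) \<in> A.par\<^sup>*" for Y Z
    using that
  proof (induction rule: rtrancl_induct)
    case (step Z W)
    then have Z: "Z \<in> A.H" "Z \<noteq> A.L" "W = A.up Z" by (auto simp: A.par_iff A.verts_hasse)
    have "f Z \<noteq> f A.L" using inj_onD[OF inj, of Z A.L] Z A.L_mem by blast
    then have "f Z \<in> B.H" "f Z \<noteq> B.L" using im Z(1) f(3) by auto
    then have "f Z \<subseteq> f W" using B.up_mem(2) up Z by auto
    then show ?case using step.IH by blast
  qed simp
  fix a assume a: "a \<in> X - {P}"
  then have aL: "a \<in> A.L" "a \<noteq> P" using A.H_subset[OF X] by auto
  then have "({a}, X) \<in> A.par\<^sup>*" using a X A.singleton_mem by (intro A.subset_par) auto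
  then have "f {a} \<subseteq> f X" by (rule mono)
  then show "a \<in> f X" using f(4)[OF aL] by simp
qed

text \<open>Applying \<open>hasse_tree_iso_subset\<close> to \<open>f\<close> and to its inverse
  shows that \<open>f\<close> fixes each member of \<open>F\<close>. Its image lies in the second
  hierarchy and is neither \<open>L\<close>, \<open>L - {P}\<close> nor a singleton, so it is in
  \<open>F'\<close>.\<close>

lemma hasse_tree_iso_mono:
  assumes F: "cluster_hierarchy \<Gamma> P F" and F': "cluster_hierarchy \<Gamma> P F'"
    and iso: "label_iso (verts \<Gamma>) (hasse_tree (verts \<Gamma>) P F) (hasse_tree (verts \<Gamma>) P F')"
  shows "F \<subseteq> F'"
proof
  interpret A: cluster_hierarchy \<Gamma> P F by fact
  interpret B: cluster_hierarchy \<Gamma> P F' by fact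
  let ?S = "hasse_tree A.L P F" and ?T = "hasse_tree A.L P F'"
  obtain f where f: "bij_betw f A.H B.H" "(\<lambda>e. f ` e) ` edges ?S = edges ?T"
    "\<forall>a\<in>A.L. f (leaf_of ?S a) = leaf_of ?T a"
    using iso unfolding label_iso_def A.verts_hasse B.verts_hasse by (elim exE conjE)
  have fL: "f A.L = A.L" using bspec[OF f(3) A.P] by (simp add: A.leaf_of_hasse B.leaf_of_hasse)
  have fs: "f {a} = {a}" if "a \<in> A.L" "a \<noteq> P" for a
    using bspec[OF f(3) that(1)] that(2) by (simp add: A.leaf_of_hasse B.leaf_of_hasse)
  let ?g = "inv_into A.H f"
  have inj: "inj_on f A.H" using f(1) by (rule bij_betw_imp_inj_on)
  have g: "?g (f X) = X" if "X \<in> A.H" for X using inv_into_f_f[OF inj that] .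
  have sub: "e \<subseteq> A.H" if "e \<in> edges ?S" for e
    using that A.finite_simple unfolding finite_simple_graph_def A.verts_hasse by blast
  have "?g ` f ` e = e" if "e \<in> edges ?S" for e
    using inv_into_image_cancel[OF inj sub[OF that]] .
  then have gE: "(\<lambda>e. ?g ` e) ` edges ?T = edges ?S"
    unfolding f(2)[symmetric] image_image by simp
  fix X assume X: "X \<in> F"
  then have XH: "X \<in> A.H" "X \<noteq> A.L" "P \<notin> X" using A.F_mem A.F_psubset A.P by auto
  have fX: "f X \<in> B.H" using f(1) XH(1) by (rule bij_betwE[rule_format])
  have "f X \<noteq> A.L" using XH fL A.L_mem inj by (metis inj_onD)
  then have "P \<notin> f X" using B.H_not_L[OF fX] by blast
  moreover have "X - {P} \<subseteq> f X"
    by (rule hasse_tree_iso_subset[OF F F' f(1,2) fL fs XH(1)])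
  moreover have "f X - {P} \<subseteq> ?g (f X)"
  proof (rule hasse_tree_iso_subset[OF F' F bij_betw_inv_into[OF f(1)] gE _ _ fX])
    show "?g A.L = A.L" using g[OF A.L_mem] fL by simp
    show "?g {a} = {a}" if "a \<in> A.L" "a \<noteq> P" for a
      using g[OF A.singleton_mem[OF that]] fs[OF that] by simp
  qed
  ultimately have "f X = X" using g[OF XH(1)] XH(3) by blast
  then have "X \<in> B.H" using fX by simp
  then show "X \<in> F'"
  proof (cases rule: B.H_cases)
    case (2 a)
    then show ?thesis using A.inner_not_singleton[of X a] X by blast
  next
    case 3
    then show ?thesis using A.F_psubset[OF X] by blast
  qed (use XH(2) in simp)
qed

lemma hasse_tree_iso_unique:
  assumes "cluster_hierarchy \<Gamma> P F" "cluster_hierarchy \<Gamma> P F'"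
    and "label_iso (verts \<Gamma>) (hasse_tree (verts \<Gamma>) P F) (hasse_tree (verts \<Gamma>) P F')"
  shows "F = F'"
proof -
  interpret A: cluster_hierarchy \<Gamma> P F by fact
  have "leaf_of (hasse_tree (verts \<Gamma>) P F) ` verts \<Gamma> \<subseteq> verts (hasse_tree (verts \<Gamma>) P F)"
    using A.stable_hasse_tree unfolding stable_tree_def bij_betw_def leaves_def by blast
  then have "label_iso (verts \<Gamma>) (hasse_tree (verts \<Gamma>) P F') (hasse_tree (verts \<Gamma>) P F)"
    using label_iso_sym[OF A.finite_simple assms(3)] by blast
  then show ?thesis using hasse_tree_iso_mono assms by (metis subset_antisym)
qed

section \<open>Renaming vertices along an injection\<close>

definition rename :: "('v \<Rightarrow> 'w) \<Rightarrow> ('v, 'a) labelled_graph \<Rightarrow> ('w, 'a) labelled_graph" where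
  "rename f S = \<lparr>verts = f ` verts S, edges = (\<lambda>e. f ` e) ` edges S, leaf_of = f \<circ> leaf_of S\<rparr>"

lemma label_iso_rename: "inj_on f (verts S) \<Longrightarrow> label_iso A S (rename f S)"
  unfolding label_iso_def rename_def by (intro exI[of _ f]) (auto simp: inj_on_imp_bij_betw)

lemma is_tree_rename:
  assumes S: "is_tree S" and f: "inj_on f (verts S)"
  shows "is_tree (rename f S)"
proof -
  have fs: "finite_simple_graph S" and conn: "connected_graph S" and nc: "\<nexists>vs. is_cycle S vs"
    using S unfolding is_tree_def by auto
  have sub: "e \<subseteq> verts S" "card e = 2" if "e \<in> edges S" for e
    using fs that unfolding finite_simple_graph_def by auto
  have "finite_simple_graph (rename f S)"
    using fs sub card_image[OF inj_on_subset[OF f]]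
    unfolding finite_simple_graph_def rename_def by auto
  moreover have "connected_graph (rename f S)"
  proof -
    have "(f u, f v) \<in> (adj_rel (rename f S))\<^sup>*" if "(u, v) \<in> (adj_rel S)\<^sup>*" for u v
      using that
    proof (induction rule: rtrancl_induct)
      case (step v w)
      then have "f ` {v, w} \<in> (\<lambda>e. f ` e) ` edges S" unfolding adj_rel_def by blast
      then have "(f v, f w) \<in> adj_rel (rename f S)" unfolding adj_rel_def rename_def by simp
      then show ?case using step.IH by (rule rtrancl_into_rtrancl[rotated])
    qed simp
    then show ?thesis using conn unfolding connected_graph_def rename_def by auto
  qed
  moreover have "\<not> is_cycle (rename f S) vs" for vs
  proof
    let ?g = "inv_into (verts S) f"
    assume vs: "is_cycle (rename f S) vs"
    have edge: "?g ` e \<in> edges S" "e \<subseteq> f ` verts S" if e: "e \<in> edges (rename f S)" for e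
    proof -
      obtain e' where "e' \<in> edges S" "e = f ` e'" using e unfolding rename_def by auto
      then show "?g ` e \<in> edges S" "e \<subseteq> f ` verts S"
        using sub(1) inv_into_image_cancel[OF f] by auto
    qed
    have step: "{vs ! i, vs ! (Suc i mod length vs)} \<in> edges (rename f S)" if "i < length vs" for i
      using vs that unfolding is_cycle_def by blast
    have "set vs \<subseteq> f ` verts S"
      using edge(2)[OF step] by (auto simp: in_set_conv_nth)
    then have inj: "inj_on ?g (set vs)" by (rule inj_on_inv_into)
    have "is_cycle S (map ?g vs)"
      unfolding is_cycle_def
    proof (intro conjI allI impI)
      show "3 \<le> length (map ?g vs)" "distinct (map ?g vs)"
        using vs inj unfolding is_cycle_def by (auto simp: distinct_map)
      fix i assume i: "i < length (map ?g vs)"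
      then have "Suc i mod length vs < length vs" by (intro mod_less_divisor) auto
      then show "{map ?g vs ! i, map ?g vs ! (Suc i mod length (map ?g vs))} \<in> edges S"
        using edge(1)[OF step[of i]] i by simp
    qed
    then show False using nc by blast
  qed
  ultimately show ?thesis unfolding is_tree_def by blast
qed

lemma stable_tree_rename:
  assumes S: "stable_tree \<Gamma> S" and f: "inj_on f (verts S)"
  shows "stable_tree \<Gamma> (rename f S)"
proof -
  have tree: "is_tree S" and leaf: "bij_betw (leaf_of S) (verts \<Gamma>) (leaves S)"
    and deg3: "\<And>v. v \<in> internal_verts S \<Longrightarrow> 3 \<le> degree S v"
    and comp: "\<And>e C. e \<in> internal_edges S \<Longrightarrow> C \<in> conn_components (delete_edge S e) \<Longrightarrow>
        \<exists>a b. {a, b} \<in> edges \<Gamma> \<and> leaf_of S a \<in> C \<and> leaf_of S b \<in> C"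
    using S unfolding stable_tree_def by blast+
  have sub: "e \<subseteq> verts S" if "e \<in> edges S" for e
    using tree that unfolding is_tree_def finite_simple_graph_def by blast
  have injE: "inj_on (\<lambda>e. f ` e) (edges S)"
    using inj_on_image_eq_iff[OF f sub sub] by (intro inj_onI) blast
  have deg: "degree (rename f S) (f v) = degree S v" if v: "v \<in> verts S" for v
  proof -
    have "f v \<in> f ` e \<longleftrightarrow> v \<in> e" if "e \<in> edges S" for e
      using inj_on_image_mem_iff[OF f v sub[OF that]] .
    then have "{e \<in> edges (rename f S). f v \<in> e} = (\<lambda>e. f ` e) ` {e \<in> edges S. v \<in> e}"
      unfolding rename_def by auto
    moreover have "inj_on (\<lambda>e. f ` e) {e \<in> edges S. v \<in> e}"
      by (rule inj_on_subset[OF injE]) blast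
    ultimately show ?thesis unfolding degree_def by (simp add: card_image)
  qed
  have vr: "verts (rename f S) = f ` verts S" unfolding rename_def by simp
  have leaves: "leaves (rename f S) = f ` leaves S"
    unfolding leaves_def vr using deg by auto
  have internal: "internal_verts (rename f S) = f ` internal_verts S"
    unfolding internal_verts_def vr leaves
    by (rule inj_on_image_set_diff[OF f, symmetric]) (auto simp: leaves_def)
  have "bij_betw f (leaves S) (f ` leaves S)"
    by (rule inj_on_imp_bij_betw, rule inj_on_subset[OF f]) (auto simp: leaves_def)
  with leaf have "bij_betw (f \<circ> leaf_of S) (verts \<Gamma>) (leaves (rename f S))"
    unfolding leaves by (rule bij_betw_trans)
  moreover have "3 \<le> degree (rename f S) v" if "v \<in> internal_verts (rename f S)" for v
    using that deg deg3 unfolding internal by (auto simp: internal_verts_def)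
  moreover have "\<exists>a b. {a, b} \<in> edges \<Gamma> \<and> f (leaf_of S a) \<in> C \<and> f (leaf_of S b) \<in> C"
    if e: "e \<in> internal_edges (rename f S)" and C: "C \<in> conn_components (delete_edge (rename f S) e)"
    for e C
  proof -
    have "e \<in> edges (rename f S)" and ev: "e \<subseteq> f ` internal_verts S"
      using e unfolding internal_edges_def internal by auto
    then obtain e' where e': "e' \<in> edges S" "e = f ` e'" by (auto simp: rename_def)
    have "x \<in> internal_verts S" if x: "x \<in> e'" for x
    proof -
      obtain y where y: "y \<in> internal_verts S" "f x = f y" using ev e'(2) x by blast
      then have "x = y" using inj_onD[OF f] sub[OF e'(1)] x unfolding internal_verts_def by blast
      then show ?thesis using y(1) by simp
    qed
    then have ie: "e' \<in> internal_edges S" using e'(1) unfolding internal_edges_def by blast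
    let ?R = "adj_rel (delete_edge S e')" and ?R' = "adj_rel (delete_edge (rename f S) e)"
    obtain u where u: "u \<in> verts S" "C = component_of (delete_edge (rename f S) e) (f u)"
      using C unfolding conn_components_def delete_edge_def by (auto simp: vr)
    have path: "(f u, f v) \<in> ?R'\<^sup>*" if "(u, v) \<in> ?R\<^sup>*" for v
      using that
    proof (induction rule: rtrancl_induct)
      case (step v w)
      then have vw: "{v, w} \<in> edges S" "{v, w} \<noteq> e'" unfolding adj_rel_def delete_edge_def by auto
      then have "f ` {v, w} \<noteq> f ` e'" using injE e'(1) by (metis inj_onD)
      moreover have "f ` {v, w} \<in> edges (rename f S)"
        using imageI[OF vw(1), of "\<lambda>e. f ` e"] unfolding rename_def by simp
      ultimately have "(f v, f w) \<in> ?R'"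
        unfolding adj_rel_def delete_edge_def e'(2) by simp
      then show ?case using step.IH by (rule rtrancl_into_rtrancl[rotated])
    qed simp
    \<comment> \<open>This one inclusion suffices: the two adjacent labels demanded of
      \<open>C\<close> are already found in the image of the old component.\<close>
    have sub: "f ` component_of (delete_edge S e') u \<subseteq> C"
      using path unfolding u(2) component_of_def by (auto simp: vr delete_edge_def)
    have "component_of (delete_edge S e') u \<in> conn_components (delete_edge S e')"
      unfolding conn_components_def using u(1) by (simp add: delete_edge_def)
    from comp[OF ie this] show ?thesis using sub by blast
  qed
  ultimately show ?thesis
    using is_tree_rename[OF tree f] unfolding stable_tree_def by (simp add: rename_def)
qed

text \<open>A Hasse tree has sets as vertices while \<open>Tree\<close> consists of classes of
  graphs on \<open>nat\<close>, so the class is described by isomorphism across the two vertex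
  types.\<close>

definition cluster_class :: "'a sgraph \<Rightarrow> 'a \<Rightarrow> 'a set set \<Rightarrow> (nat, 'a) labelled_graph set" where
  "cluster_class \<Gamma> P F =
     {T. stable_tree \<Gamma> T \<and> label_iso (verts \<Gamma>) T (hasse_tree (verts \<Gamma>) P F)}"

section \<open>Bijection between cluster families and classes of stable trees\<close>

context
  fixes \<Gamma> :: "'a sgraph" and P :: 'a
  assumes simple: "finite_simple_graph \<Gamma>" and dom: "dominating \<Gamma> P" and card3: "3 \<le> card (verts \<Gamma>)"
begin

lemma cluster_hierarchyI: "F \<in> cluster_families \<Gamma> P \<Longrightarrow> cluster_hierarchy \<Gamma> P F"
  using simple dom card3 by unfold_locales

lemma stable_label_iso_sym:
  assumes "stable_tree \<Gamma> S" "label_iso (verts \<Gamma>) S T"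
  shows "label_iso (verts \<Gamma>) T S"
proof (rule label_iso_sym[OF _ assms(2)])
  show "finite_simple_graph S" using assms(1) unfolding stable_tree_def is_tree_def by blast
  show "leaf_of S ` verts \<Gamma> \<subseteq> verts S"
    using assms(1) unfolding stable_tree_def bij_betw_def leaves_def by blast
qed

lemma cluster_class_nonempty:
  assumes "F \<in> cluster_families \<Gamma> P"
  shows "cluster_class \<Gamma> P F \<noteq> {}"
proof -
  interpret cluster_hierarchy \<Gamma> P F by (rule cluster_hierarchyI[OF assms])
  let ?K = "hasse_tree L P F"
  obtain f :: "'a set \<Rightarrow> nat" where "inj_on f (verts ?K)"
    using finite_imp_inj_to_nat_seg[OF finite_verts] by blast
  then have "stable_tree \<Gamma> (rename f ?K)" "label_iso L ?K (rename f ?K)"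
    using stable_tree_rename[OF stable_hasse_tree] label_iso_rename by blast+
  then have "rename f ?K \<in> cluster_class \<Gamma> P F"
    using stable_label_iso_sym[OF stable_hasse_tree] unfolding cluster_class_def by blast
  then show ?thesis by blast
qed

lemma stable_tree_rel_Image:
  assumes "T \<in> cluster_class \<Gamma> P F"
  shows "stable_tree_rel \<Gamma> `` {T} = cluster_class \<Gamma> P F"
proof (intro set_eqI iffI)
  let ?K = "hasse_tree (verts \<Gamma>) P F"
  have T: "stable_tree \<Gamma> T" "label_iso (verts \<Gamma>) T ?K"
    using assms unfolding cluster_class_def by auto
  fix S
  show "S \<in> cluster_class \<Gamma> P F" if "S \<in> stable_tree_rel \<Gamma> `` {T}"
  proof -
    have S: "stable_tree \<Gamma> S" "label_iso (verts \<Gamma>) T S"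
      using that unfolding stable_tree_rel_def by auto
    then have "label_iso (verts \<Gamma>) S ?K"
      using label_iso_trans[OF stable_label_iso_sym[OF T(1) S(2)] T(2)] by simp
    then show ?thesis using S(1) unfolding cluster_class_def by simp
  qed
  show "S \<in> stable_tree_rel \<Gamma> `` {T}" if "S \<in> cluster_class \<Gamma> P F"
  proof -
    have S: "stable_tree \<Gamma> S" "label_iso (verts \<Gamma>) S ?K"
      using that unfolding cluster_class_def by auto
    then have "label_iso (verts \<Gamma>) T S"
      using label_iso_trans[OF T(2) stable_label_iso_sym[OF S]] by simp
    then show ?thesis using S(1) T(1) unfolding stable_tree_rel_def by simp
  qed
qed

lemma Tree_eq_image: "Tree \<Gamma> = cluster_class \<Gamma> P ` cluster_families \<Gamma> P"
proof (intro set_eqI iffI)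
  fix X assume "X \<in> Tree \<Gamma>"
  then obtain T where T: "stable_tree \<Gamma> T" "X = stable_tree_rel \<Gamma> `` {T}"
    unfolding Tree_def by (auto elim: quotientE)
  have "P \<in> verts \<Gamma>" using dom unfolding dominating_def by blast
  then obtain F where F: "F \<in> cluster_families \<Gamma> P" "label_iso (verts \<Gamma>) T (hasse_tree (verts \<Gamma>) P F)"
    using stable_tree_label_iso_hasse_tree[OF T(1) simple _ card3] by blast
  then have "T \<in> cluster_class \<Gamma> P F" using T(1) unfolding cluster_class_def by simp
  then show "X \<in> cluster_class \<Gamma> P ` cluster_families \<Gamma> P"
    using stable_tree_rel_Image T(2) F(1) by blast
next
  fix X assume "X \<in> cluster_class \<Gamma> P ` cluster_families \<Gamma> P"
  then obtain F where F: "F \<in> cluster_families \<Gamma> P" "X = cluster_class \<Gamma> P F" by blast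
  obtain T where T: "T \<in> cluster_class \<Gamma> P F" using cluster_class_nonempty[OF F(1)] by blast
  then have "stable_tree \<Gamma> T" unfolding cluster_class_def by simp
  then show "X \<in> Tree \<Gamma>"
    unfolding Tree_def F(2) stable_tree_rel_Image[OF T, symmetric] by (intro quotientI) simp
qed

lemma inj_cluster_class: "inj_on (cluster_class \<Gamma> P) (cluster_families \<Gamma> P)"
proof (rule inj_onI)
  fix F F'
  assume F: "F \<in> cluster_families \<Gamma> P" "F' \<in> cluster_families \<Gamma> P"
    and eq: "cluster_class \<Gamma> P F = cluster_class \<Gamma> P F'"
  obtain T where "T \<in> cluster_class \<Gamma> P F" "T \<in> cluster_class \<Gamma> P F'"
    using cluster_class_nonempty[OF F(1)] eq by blast
  then have "label_iso (verts \<Gamma>) (hasse_tree (verts \<Gamma>) P F) (hasse_tree (verts \<Gamma>) P F')"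
    using stable_label_iso_sym label_iso_trans unfolding cluster_class_def by blast
  then show "F = F'"
    by (rule hasse_tree_iso_unique[OF cluster_hierarchyI[OF F(1)] cluster_hierarchyI[OF F(2)]])
qed

lemma num_internal_edges_cluster_class:
  assumes "F \<in> cluster_families \<Gamma> P"
  shows "num_internal_edges (cluster_class \<Gamma> P F) = card F"
proof -
  interpret cluster_hierarchy \<Gamma> P F by (rule cluster_hierarchyI[OF assms])
  obtain T where T: "T \<in> cluster_class \<Gamma> P F" using cluster_class_nonempty[OF assms] by blast
  then have "finite_simple_graph T" "label_iso L T (hasse_tree L P F)"
    unfolding cluster_class_def stable_tree_def is_tree_def by auto
  then have "card (internal_edges T) = card F"
    using label_iso_card_internal_edges card_internal_edges_hasse by metis
  moreover have "cluster_class \<Gamma> P F \<in> Tree \<Gamma>" unfolding Tree_eq_image using assms by simp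
  ultimately show ?thesis using num_internal_edges_eq T by metis
qed

lemma signed_tree_count:
  "(\<Sum>T\<in>Tree \<Gamma>. (- 1 :: int) ^ num_internal_edges T) =
     signed_count (edge_sets \<Gamma> (verts \<Gamma> - {P}) - {verts \<Gamma> - {P}})"
  unfolding Tree_eq_image signed_count_def sum.reindex[OF inj_cluster_class] o_def
  by (rule sum.cong) (simp_all add: num_internal_edges_cluster_class cluster_families_def)

end

theorem theorem3p1:
  fixes n P Q :: nat and \<Gamma> :: "nat sgraph"
  assumes "n \<ge> 1"
    and "P \<noteq> Q" and "P \<notin> {1..n}" and "Q \<notin> {1..n}"
    and "finite_simple_graph \<Gamma>"
    and "verts \<Gamma> = {P, Q} \<union> {1..n}"
    and "dominating \<Gamma> P" and "dominating \<Gamma> Q"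
  shows "\<bar>\<Sum>T\<in>Tree \<Gamma>. (- 1 :: int) ^ num_internal_edges T\<bar> =
         int (card (acyclic_orientations (induced_subgraph \<Gamma> (verts \<Gamma> - {P, Q}))))"
proof -
  let ?N = "{1..n}"
  have minus: "verts \<Gamma> - {P} = insert Q ?N" "verts \<Gamma> - {P, Q} = ?N"
    using assms(2-4,6) by auto
  have "card (verts \<Gamma>) = n + 2" using assms(2-4,6) by simp
  then have "3 \<le> card (verts \<Gamma>)" using assms(1) by simp
  then have "(\<Sum>T\<in>Tree \<Gamma>. (- 1 :: int) ^ num_internal_edges T) =
      signed_count (edge_sets \<Gamma> (insert Q ?N) - {insert Q ?N})"
    using signed_tree_count[OF assms(5,7)] unfolding minus by blast
  moreover have "{Q, v} \<in> edges \<Gamma>" if "v \<in> ?N" for v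
    using that assms(4,6,8) unfolding dominating_def by auto
  \<comment> \<open>As \<open>n \<ge> 1\<close>, the set \<open>?N\<close> is nonempty and the
    negative branch of \<open>signed_count_cone\<close> applies; without the absolute value the sum
    is thus \<open>(- 1) ^ (n + 1)\<close> times the count.\<close>
  then have "- signed_count (edge_sets \<Gamma> (insert Q ?N) - {insert Q ?N}) =
      (- 1) ^ card ?N * int (card (acyclic_orientations (induced_subgraph \<Gamma> ?N)))"
    using signed_count_cone[OF assms(5), of ?N Q] assms(1,4) by simp
  ultimately have "\<bar>\<Sum>T\<in>Tree \<Gamma>. (- 1 :: int) ^ num_internal_edges T\<bar> =
      \<bar>(- 1) ^ card ?N * int (card (acyclic_orientations (induced_subgraph \<Gamma> ?N)))\<bar>"
    by (metis abs_minus_cancel)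
  then show ?thesis unfolding minus by (simp add: abs_mult power_abs)
qed

end
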